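(* Let $s>r>0$, $B\ge1$ and $0<\alpha<1$. There exists a confidence band $C_n:=C_n(B,r,s,\alpha;X_1,\ldots,X_n)$ that has asymptotic coverage for every fixed $f\in\mathcal P^{\mathrm{all}}:=\Sigma(s)\cup\Sigma(r)=\Sigma(r)$; that is, $$\liminf_n\Pr\nolimits_f(f\in C_n)\ge1-\alpha\qquad\text{for all } f\in\mathcal P^{\mathrm{all}},$$ and such that $$f\in\Sigma(s)\ \Rightarrow\ E_f|C_n|=O(r_n(s)),\qquad f\in\Sigma(r)\ \Rightarrow\ E_f|C_n|=O(r_n(r)).$$
   Context: Observations: $X_1,\ldots,X_n$ are i.i.d. random variables with values in $[0,1]$ and common probability density $f$; $\Pr_f$ and $E_f$ denote the joint law and the corresponding expectation. Hölder norm: fix an $S$-regular Daubechies wavelet basis of $L^2([0,1])$ (boundary-corrected), with $S$ larger than all smoothness indices considered: scaling functions $\phi_k$, $k=1,\ldots,N$, and wavelets $\psi_{lk}=2^{l/2}\psi_k(2^l\cdot)$, $l\ge J_0$, $k=1,\ldots,2^l$, with $\phi_k,\psi_k$ compactly supported and $S$ times continuously differentiable. For continuous $f$ on $[0,1]$ put $\alpha_k(f)=\int f\phi_k$, $\beta_{lk}(f)=\int f\psi_{lk}$ and $\|f\|_{s,\infty}=\max\bigl(\sup_k|\alpha_k(f)|,\ \sup_{k,l}2^{l(s+1/2)}|\beta_{lk}(f)|\bigr)$. Classes of densities: $\Sigma(s)=\Sigma(s,B)=\{f:[0,1]\to[0,\infty)\text{ continuous},\ \int_0^1 f=1,\ \|f\|_{s,\infty}\le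 B\}$, so $\Sigma(s)\subset\Sigma(r)$ for $s>r$. Rate: $r_n(s)=(\log n/n)^{s/(2s+1)}$. Confidence band: $C_n=C_n(X_1,\ldots,X_n)$ is a family of random intervals $\{C_n(y)=[c_n(y),c_n'(y)]\}_{y\in[0,1]}$; its maximal diameter is $|C_n|=\sup_{y\in[0,1]}|c_n'(y)-c_n(y)|$. $\{f\in C_n\}$ means $f(y)\in C_n(y)$ for all $y\in[0,1]$. *)

theory Defs
  imports "HOL-Probability.Probability" "HOL-Library.Landau_Symbols"
begin

text \<open>Functions on the unit interval are represented by functions \<^typ>\<open>real \<Rightarrow> real\<close> of which
  only the values on \<^term>\<open>{0..1::real}\<close> matter.\<close>

definition inner01 :: "(real \<Rightarrow> real) \<Rightarrow> (real \<Rightarrow> real) \<Rightarrow> real" where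
  "inner01 u v = (LINT x:{0..1}|lborel. u x * v x)"

definition times_cont_diff :: "nat \<Rightarrow> (real \<Rightarrow> real) \<Rightarrow> bool" where
  "times_cont_diff S g \<longleftrightarrow>
     (\<forall>i<S. (deriv ^^ i) g differentiable_on UNIV) \<and> continuous_on UNIV ((deriv ^^ S) g)"

text \<open>Daubechies' filters of order \<open>M\<close>: the orthonormal filters of minimal length \<open>2 M\<close> whose
  associated wavelet has \<open>M\<close> vanishing moments, placed so that the scaling function and the wavelet
  live on \<open>[-M+1, M]\<close>.  Every choice of the spectral factorisation (extremal phase, least
  asymmetric, ...) is covered.\<close>

definition daubechies_filter :: "nat \<Rightarrow> (int \<Rightarrow> real) \<Rightarrow> bool" where
  "daubechies_filter M h \<longleftrightarrow>
     M \<ge> 1 \<and>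
     (\<forall>k. k \<notin> {- int M + 1..int M} \<longrightarrow> h k = 0) \<and>
     (\<Sum>k\<in>{- int M + 1..int M}. h k) = sqrt 2 \<and>
     (\<forall>m. (\<Sum>k\<in>{- int M + 1..int M}. h k * h (k + 2 * m)) = of_bool (m = 0)) \<and>
     (\<forall>p<M. (\<Sum>k\<in>{- int M + 1..int M}. (-1) powi k * of_int k ^ p * h k) = 0)"

definition daubechies_pair ::
  "nat \<Rightarrow> (int \<Rightarrow> real) \<Rightarrow> (real \<Rightarrow> real) \<Rightarrow> (real \<Rightarrow> real) \<Rightarrow> bool" where
  "daubechies_pair M h \<phi> \<psi> \<longleftrightarrow>
     daubechies_filter M h \<and>
     (\<forall>x. x \<notin> {- real M + 1..real M} \<longrightarrow> \<phi> x = 0) \<and>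
     set_integrable lborel {- real M + 1..real M} \<phi> \<and>
     (LINT x:{- real M + 1..real M}|lborel. \<phi> x) = 1 \<and>
     (\<forall>x. \<phi> x = sqrt 2 * (\<Sum>k\<in>{- int M + 1..int M}. h k * \<phi> (2 * x - of_int k))) \<and>
     (\<forall>x. \<psi> x = sqrt 2 *
        (\<Sum>k\<in>{- int M + 1..int M}. (-1) powi k * h (1 - k) * \<phi> (2 * x - of_int k)))"

text \<open>Boundary correction of Cohen, Daubechies and Vial.  Of the translates of \<open>\<phi>\<close> those within
  \<open>M\<close> of an end point are replaced by \<open>M\<close> edge functions: linear combinations of the functions
  below, which complement the interior translates so as to reproduce the polynomials of degree less
  than \<open>M\<close>.  The left end is \<open>0\<close> of the half line \<open>[0, \<infinity>)\<close>, the right end is \<open>0\<close> of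
  \<open>(-\<infinity>, 0]\<close>.  The edge wavelets are linear combinations of scaling functions of the next finer
  level.  The coefficients are left free here; they are constrained by the requirement, in
  \<open>daubechies_interval_basis\<close>, that the whole system be orthonormal on the unit interval.\<close>

definition left_edge_sum :: "nat \<Rightarrow> (real \<Rightarrow> real) \<Rightarrow> nat \<Rightarrow> real \<Rightarrow> real" where
  "left_edge_sum M \<phi> q x =
     (\<Sum>n\<in>{0..2 * M - 2}. real (n choose q) * \<phi> (x + real n - real M + 1))"

definition right_edge_sum :: "nat \<Rightarrow> (real \<Rightarrow> real) \<Rightarrow> nat \<Rightarrow> real \<Rightarrow> real" where
  "right_edge_sum M \<phi> q x =
     (\<Sum>n\<in>{0..2 * M - 2}. real (n choose q) * \<phi> (x - real n + real M))"

definition edge_scaling ::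
  "nat \<Rightarrow> (real \<Rightarrow> real) \<Rightarrow> (nat \<Rightarrow> real \<Rightarrow> real) \<Rightarrow> (nat \<Rightarrow> real \<Rightarrow> real) \<Rightarrow> bool" where
  "edge_scaling M \<phi> \<phi>L \<phi>R \<longleftrightarrow>
     (\<exists>a b :: nat \<Rightarrow> nat \<Rightarrow> real. \<forall>i<M. \<forall>x.
        \<phi>L i x = (\<Sum>q<M. a i q * left_edge_sum M \<phi> q x) \<and>
        \<phi>R i x = (\<Sum>q<M. b i q * right_edge_sum M \<phi> q x))"

definition edge_wavelets ::
  "nat \<Rightarrow> (real \<Rightarrow> real) \<Rightarrow> (nat \<Rightarrow> real \<Rightarrow> real) \<Rightarrow> (nat \<Rightarrow> real \<Rightarrow> real) \<Rightarrow>
   (nat \<Rightarrow> real \<Rightarrow> real) \<Rightarrow> (nat \<Rightarrow> real \<Rightarrow> real) \<Rightarrow> bool" where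
  "edge_wavelets M \<phi> \<phi>L \<phi>R \<psi>L \<psi>R \<longleftrightarrow>
     (\<exists>a b c d :: nat \<Rightarrow> nat \<Rightarrow> real. \<forall>i<M. \<forall>x.
        \<psi>L i x = (\<Sum>q<M. a i q * \<phi>L q (2 * x)) +
                 (\<Sum>m\<in>{M..3 * M - 2}. b i m * \<phi> (2 * x - real m)) \<and>
        \<psi>R i x = (\<Sum>q<M. c i q * \<phi>R q (2 * x)) +
                 (\<Sum>m\<in>{M..3 * M - 2}. d i m * \<phi> (2 * x + real m + 1)))"

text \<open>The level-\<open>l\<close> functions on the unit interval, indexed by \<open>k = 1, ..., 2^l\<close>: first \<open>M\<close> left edge
  functions, then the interior translates by \<open>k - 1\<close>, finally \<open>M\<close> right edge functions.\<close>

definition interval_family ::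
  "nat \<Rightarrow> (nat \<Rightarrow> real \<Rightarrow> real) \<Rightarrow> (real \<Rightarrow> real) \<Rightarrow> (nat \<Rightarrow> real \<Rightarrow> real) \<Rightarrow>
   nat \<Rightarrow> nat \<Rightarrow> real \<Rightarrow> real" where
  "interval_family M gL g gR l k x =
     2 powr (real l / 2) *
       (if k \<le> M then gL (k - 1) (2 ^ l * x)
        else if k \<le> 2 ^ l - M then g (2 ^ l * x - real (k - 1))
        else gR (2 ^ l - k) (2 ^ l * (x - 1)))"

text \<open>Orthonormal basis of \<open>L\<^sup>2([0,1])\<close>: an orthonormal system such that every square integrable
  function is the \<open>L\<^sup>2\<close> limit of its expansion.\<close>

definition orthonormal_basis01 ::
  "nat \<Rightarrow> (nat \<Rightarrow> real \<Rightarrow> real) \<Rightarrow> (nat \<Rightarrow> nat \<Rightarrow> real \<Rightarrow> real) \<Rightarrow> bool" where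
  "orthonormal_basis01 J0 scl wav \<longleftrightarrow>
     (\<forall>k\<in>{1..2 ^ J0}. \<forall>k'\<in>{1..2 ^ J0}. inner01 (scl k) (scl k') = of_bool (k = k')) \<and>
     (\<forall>k\<in>{1..2 ^ J0}. \<forall>l\<ge>J0. \<forall>k'\<in>{1..2 ^ l}. inner01 (scl k) (wav l k') = 0) \<and>
     (\<forall>l\<ge>J0. \<forall>k\<in>{1..2 ^ l}. \<forall>l'\<ge>J0. \<forall>k'\<in>{1..2 ^ l'}.
        inner01 (wav l k) (wav l' k') = of_bool (l = l' \<and> k = k')) \<and>
     (\<forall>g. set_borel_measurable lborel {0..1} g \<and> set_integrable lborel {0..1} (\<lambda>x. (g x)\<^sup>2) \<longrightarrow>
        (\<lambda>J. LINT x:{0..1}|lborel.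
               (g x - (\<Sum>k\<in>{1..2 ^ J0}. inner01 g (scl k) * scl k x)
                    - (\<Sum>l\<in>{J0..<J}. \<Sum>k\<in>{1..2 ^ l}. inner01 g (wav l k) * wav l k x))\<^sup>2)
          \<longlonglongrightarrow> 0)"

definition daubechies_interval_basis ::
  "nat \<Rightarrow> nat \<Rightarrow> (nat \<Rightarrow> real \<Rightarrow> real) \<Rightarrow> (nat \<Rightarrow> nat \<Rightarrow> real \<Rightarrow> real) \<Rightarrow> bool" where
  "daubechies_interval_basis S J0 scl wav \<longleftrightarrow>
     (\<exists>M h \<phi> \<psi> \<phi>L \<phi>R \<psi>L \<psi>R.
        daubechies_pair M h \<phi> \<psi> \<and> times_cont_diff S \<phi> \<and>
        2 * M \<le> 2 ^ J0 \<and>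
        edge_scaling M \<phi> \<phi>L \<phi>R \<and> edge_wavelets M \<phi> \<phi>L \<phi>R \<psi>L \<psi>R \<and>
        (\<forall>k\<in>{1..2 ^ J0}. \<forall>x\<in>{0..1}. scl k x = interval_family M \<phi>L \<phi> \<phi>R J0 k x) \<and>
        (\<forall>l\<ge>J0. \<forall>k\<in>{1..2 ^ l}. \<forall>x\<in>{0..1}. wav l k x = interval_family M \<psi>L \<psi> \<psi>R l k x)) \<and>
     orthonormal_basis01 J0 scl wav"

definition hoelder_norm ::
  "nat \<Rightarrow> (nat \<Rightarrow> real \<Rightarrow> real) \<Rightarrow> (nat \<Rightarrow> nat \<Rightarrow> real \<Rightarrow> real) \<Rightarrow> real \<Rightarrow> (real \<Rightarrow> real) \<Rightarrow> ereal" where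
  "hoelder_norm J0 scl wav s f =
     max (SUP k\<in>{1..2 ^ J0}. ereal \<bar>inner01 f (scl k)\<bar>)
         (SUP l\<in>{J0..}. SUP k\<in>{1..2 ^ l}.
            ereal (2 powr (real l * (s + 1 / 2)) * \<bar>inner01 f (wav l k)\<bar>))"

definition hoelder_densities ::
  "nat \<Rightarrow> (nat \<Rightarrow> real \<Rightarrow> real) \<Rightarrow> (nat \<Rightarrow> nat \<Rightarrow> real \<Rightarrow> real) \<Rightarrow> real \<Rightarrow> real \<Rightarrow>
   (real \<Rightarrow> real) set" where
  "hoelder_densities J0 scl wav s B =
     {f. continuous_on {0..1} f \<and> (\<forall>x\<in>{0..1}. 0 \<le> f x) \<and>
         (LINT x:{0..1}|lborel. f x) = 1 \<and> hoelder_norm J0 scl wav s f \<le> ereal B}"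

definition rate :: "real \<Rightarrow> nat \<Rightarrow> real" where
  "rate s n = (ln (real n) / real n) powr (s / (2 * s + 1))"

text \<open>A sample \<open>X\<^sub>1, ..., X\<^sub>n\<close> is a point of \<open>[0,1]\<^sup>n\<close>; the joint law of an i.i.d. sample is the
  product measure.\<close>

definition sample_space :: "nat \<Rightarrow> (nat \<Rightarrow> real) measure" where
  "sample_space n = PiM {1..n} (\<lambda>_. restrict_space borel {0..1})"

definition joint_law :: "(real \<Rightarrow> real) \<Rightarrow> nat \<Rightarrow> (nat \<Rightarrow> real) measure" where
  "joint_law f n =
     PiM {1..n} (\<lambda>_. density (restrict_space lborel {0..1}) (\<lambda>x. ennreal (f x)))"

definition diameter_of_band :: "(real \<Rightarrow> real) \<Rightarrow> (real \<Rightarrow> real) \<Rightarrow> ennreal" where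
  "diameter_of_band c c' = (SUP y\<in>{0..1}. ennreal \<bar>c' y - c y\<bar>)"

text \<open>Measurability of the diameter, an uncountable supremum, is part of the notion: otherwise its
  expectation is undefined, and \<^const>\<open>nn_integral\<close> would yield a mere lower integral.\<close>

definition random_band ::
  "nat \<Rightarrow> ((nat \<Rightarrow> real) \<Rightarrow> real \<Rightarrow> real) \<Rightarrow> ((nat \<Rightarrow> real) \<Rightarrow> real \<Rightarrow> real) \<Rightarrow> bool" where
  "random_band n c c' \<longleftrightarrow>
     (\<forall>y\<in>{0..1}. (\<lambda>X. c X y) \<in> borel_measurable (sample_space n) \<and>
                 (\<lambda>X. c' X y) \<in> borel_measurable (sample_space n)) \<and>
     (\<forall>X\<in>space (sample_space n). \<forall>y\<in>{0..1}. c X y \<le> c' X y) \<and>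
     (\<lambda>X. diameter_of_band (c X) (c' X)) \<in> borel_measurable (sample_space n)"

text \<open>For a non-measurable event \<^const>\<open>measure\<close> is \<open>0\<close>, so a positive lower bound on the coverage
  probability entails measurability of the coverage event.\<close>

definition coverage_prob ::
  "(real \<Rightarrow> real) \<Rightarrow> nat \<Rightarrow> ((nat \<Rightarrow> real) \<Rightarrow> real \<Rightarrow> real) \<Rightarrow> ((nat \<Rightarrow> real) \<Rightarrow> real \<Rightarrow> real) \<Rightarrow> real" where
  "coverage_prob f n c c' =
     measure (joint_law f n)
       {X \<in> space (joint_law f n). \<forall>y\<in>{0..1}. f y \<in> {c X y..c' X y}}"

definition expected_diameter ::
  "(real \<Rightarrow> real) \<Rightarrow> nat \<Rightarrow> ((nat \<Rightarrow> real) \<Rightarrow> real \<Rightarrow> real) \<Rightarrow> ((nat \<Rightarrow> real) \<Rightarrow> real \<Rightarrow> real) \<Rightarrow> ennreal" where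
  "expected_diameter f n c c' = (\<integral>\<^sup>+ X. diameter_of_band (c X) (c' X) \<partial>joint_law f n)"

text \<open>Since \<^const>\<open>enn2real\<close> sends \<open>\<infinity>\<close> to \<open>0\<close>, finiteness has to be asked for separately.\<close>

definition ennreal_bigo :: "(nat \<Rightarrow> ennreal) \<Rightarrow> (nat \<Rightarrow> real) \<Rightarrow> bool" where
  "ennreal_bigo e \<rho> \<longleftrightarrow>
     (\<forall>\<^sub>F n in sequentially. e n < \<top>) \<and> (\<lambda>n. enn2real (e n)) \<in> O(\<rho>)"

end

theory Submission
  imports Defs "HOL-Real_Asymp.Real_Asymp"
begin

text \<open>Bernstein's inequality makes all empirical wavelet coefficients up to level
  \<open>log\<^sub>2 (n / log n)\<close> simultaneously accurate to \<open>C sqrt (log n / n)\<close>, outside an event of probability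
  \<open>O(n\<^sup>-\<^sup>2)\<close>; \<open>C\<close> depends only on \<open>B\<close>, \<open>r\<close> and the basis, because the ball bounds \<open>\<parallel>f\<parallel>\<^sub>\<infinity>\<close>.
  The expansion of \<open>f\<close> converges uniformly, and its limit is \<open>f\<close> itself because both are continuous
  and agree in \<open>L\<^sup>2\<close>; hence the bias at resolution \<open>J\<close> is \<open>O(2\<^sup>-\<^sup>J\<^sup>s)\<close> in supremum norm.
  The band tests whether every empirical coefficient respects the \<open>\<Sigma>(s)\<close> bound up to that accuracy.
  If so, it is centred at the linear estimator with resolution \<open>J\<^sub>n(s)\<close> and its width is a multiple
  of \<open>r\<^sub>n(s)\<close>; otherwise \<open>r\<close> replaces \<open>s\<close>.  On the good event a density in \<open>\<Sigma>(s)\<close> is always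
  accepted.  A fixed density in \<open>\<Sigma>(r)\<close> outside \<open>\<Sigma>(s)\<close> violates the bound at some fixed
  coefficient by a fixed amount, so it is rejected for all large \<open>n\<close>: this is where coverage is
  only pointwise in \<open>f\<close>.\<close>

section \<open>Uniform convergence of wavelet expansions\<close>

lemma continuous_nonneg_integral_zero:
  fixes h :: "real \<Rightarrow> real"
  assumes "continuous_on {0..1} h" "\<And>x. x \<in> {0..1} \<Longrightarrow> 0 \<le> h x"
    and "(LINT x:{0..1}|lborel. h x) = 0" "x \<in> {0..1}"
  shows "h x = 0"
proof -
  have "integral {0..1} h = 0"
    using set_borel_integral_eq_integral(2)[OF borel_integrable_atLeastAtMost'[OF assms(1)]] assms(3) by simp
  then show ?thesis
    using integral_eq_0_iff[of 0 1 h] assms by auto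
qed

definition partial_expansion ::
  "(nat \<Rightarrow> nat \<Rightarrow> real \<Rightarrow> real) \<Rightarrow> (nat \<Rightarrow> nat set) \<Rightarrow> (real \<Rightarrow> real) \<Rightarrow> nat \<Rightarrow> real \<Rightarrow> real" where
  "partial_expansion e K f N x = (\<Sum>m<N. \<Sum>k\<in>K m. inner01 f (e m k) * e m k x)"

text \<open>Collects what the statistical argument asks of the basis, ordered into levels
  \<open>m\<close> of functions of size of order 2^(m/2). \<open>sum_abs_le\<close> packs size and
  localisation into one bound: it holds when boundedly many functions of a level are nonzero at each
  point.\<close>

locale wavelet_system =
  fixes e :: "nat \<Rightarrow> nat \<Rightarrow> real \<Rightarrow> real" and K :: "nat \<Rightarrow> nat set" and D Q :: real
  assumes finite_K [simp]: "finite (K m)"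
    and card_K: "real (card (K m)) \<le> Q * 2 ^ m"
    and cont: "k \<in> K m \<Longrightarrow> continuous_on {0..1} (e m k)"
    and sum_abs_le: "x \<in> {0..1} \<Longrightarrow> (\<Sum>k\<in>K m. \<bar>e m k x\<bar>) \<le> D * sqrt 2 ^ m"
    and D_ge_1: "1 \<le> D"
    and unit: "k \<in> K m \<Longrightarrow> inner01 (e m k) (e m k) = 1"
    and complete: "continuous_on {0..1} f \<Longrightarrow>
      (\<lambda>N. LINT x:{0..1}|lborel. (f x - partial_expansion e K f N x)\<^sup>2) \<longlonglongrightarrow> 0"
begin

lemma abs_le: "k \<in> K m \<Longrightarrow> x \<in> {0..1} \<Longrightarrow> \<bar>e m k x\<bar> \<le> D * sqrt 2 ^ m"
  using sum_abs_le[of x m] member_le_sum[of k "K m" "\<lambda>k. \<bar>e m k x\<bar>"] by fastforce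

lemma level_sum_le:
  assumes "x \<in> {0..1}" "\<And>k. k \<in> K m \<Longrightarrow> \<bar>c k\<bar> \<le> b" "0 \<le> b"
  shows "\<bar>\<Sum>k\<in>K m. c k * e m k x\<bar> \<le> b * D * sqrt 2 ^ m"
proof -
  have "\<bar>\<Sum>k\<in>K m. c k * e m k x\<bar> \<le> (\<Sum>k\<in>K m. b * \<bar>e m k x\<bar>)"
    by (rule order_trans[OF sum_abs]) (auto simp: abs_mult intro!: sum_mono mult_right_mono assms)
  also have "\<dots> \<le> b * (D * sqrt 2 ^ m)"
    unfolding sum_distrib_left[symmetric] using sum_abs_le[OF assms(1)] assms(3) by (rule mult_left_mono)
  finally show ?thesis by (simp add: mult.assoc)
qed

lemma continuous_partial_expansion: "continuous_on {0..1} (partial_expansion e K f N)"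
  unfolding partial_expansion_def by (intro continuous_intros cont)

lemma uniform_limit_eq:
  assumes f: "continuous_on {0..1} f"
    and lim: "uniform_limit {0..1} (partial_expansion e K f) g sequentially"
    and x: "x \<in> {0..1}"
  shows "g x = f x"
proof -
  have g: "continuous_on {0..1} g"
    by (rule uniform_limit_theorem[OF _ lim]) (auto simp: continuous_partial_expansion)
  let ?I = "\<lambda>u. (LINT x::real:{0..1}|lborel. (u x :: real))"
  have "?I (\<lambda>x. (f x - g x)\<^sup>2) \<le> \<epsilon>" if "\<epsilon> > 0" for \<epsilon> :: real
  proof -
    \<comment> \<open>The two tolerances are set so that 2 * (\<epsilon>/4) + \<epsilon>/2 =
      \<epsilon> in the split of \<open>(f x - g x)\<^sup>2\<close> below.\<close>
    have "\<forall>\<^sub>F N in sequentially. \<forall>x\<in>{0..1}. dist (partial_expansion e K f N x) (g x) < sqrt (\<epsilon> / 4)"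
      using uniform_limitD[OF lim] that by simp
    moreover have "\<forall>\<^sub>F N in sequentially. ?I (\<lambda>x. (f x - partial_expansion e K f N x)\<^sup>2) < \<epsilon> / 4"
      by (rule order_tendstoD(2)[OF complete[OF f]]) (use that in simp)
    ultimately have "\<forall>\<^sub>F N in sequentially. (\<forall>x\<in>{0..1}. dist (partial_expansion e K f N x) (g x) < sqrt (\<epsilon> / 4)) \<and>
       ?I (\<lambda>x. (f x - partial_expansion e K f N x)\<^sup>2) < \<epsilon> / 4"
      by eventually_elim blast
    then obtain N where "\<forall>x\<in>{0..1}. dist (partial_expansion e K f N x) (g x) < sqrt (\<epsilon> / 4)"
       "?I (\<lambda>x. (f x - partial_expansion e K f N x)\<^sup>2) < \<epsilon> / 4"
      using eventually_happens'[OF sequentially_bot] by blast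
    then have N: "\<And>x. x\<in>{0..1} \<Longrightarrow> \<bar>partial_expansion e K f N x - g x\<bar> < sqrt (\<epsilon> / 4)"
       "?I (\<lambda>x. (f x - partial_expansion e K f N x)\<^sup>2) < \<epsilon> / 4"
      by (simp_all add: dist_real_def)
    let ?P = "partial_expansion e K f N"
    have "(f x - g x)\<^sup>2 \<le> 2 * (f x - ?P x)\<^sup>2 + \<epsilon> / 2" if "x \<in> {0..1}" for x
    proof -
      have "(?P x - g x)\<^sup>2 \<le> \<epsilon> / 4"
        using N(1)[OF that] power_mono[of "\<bar>?P x - g x\<bar>" "sqrt (\<epsilon>/4)" 2] \<open>\<epsilon> > 0\<close> by simp
      \<comment> \<open>With a = \<open>f x - ?P x\<close> and b = \<open>?P x - g x\<close>, this
        square yields (a + b)^2 \<le> 2 a^2 + 2 b^2.\<close>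
      moreover have "0 \<le> ((f x - ?P x) - (?P x - g x))\<^sup>2" by simp
      ultimately show ?thesis by (simp add: power2_eq_square algebra_simps)
    qed
    then have "?I (\<lambda>x. (f x - g x)\<^sup>2) \<le> ?I (\<lambda>x. 2 * (f x - ?P x)\<^sup>2 + \<epsilon> / 2)"
      by (intro set_integral_mono borel_integrable_atLeastAtMost' continuous_intros f g
          continuous_partial_expansion) auto
    also have "\<dots> = 2 * ?I (\<lambda>x. (f x - ?P x)\<^sup>2) + ?I (\<lambda>x. \<epsilon> / 2)"
      by (subst set_integral_add(2))
         (auto intro!: borel_integrable_atLeastAtMost' continuous_intros f g continuous_partial_expansion)
    also have "?I (\<lambda>x. \<epsilon> / 2) = \<epsilon> / 2"
      by (simp add: set_lebesgue_integral_def)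
    finally show ?thesis using N(2) by simp
  qed
  then have "?I (\<lambda>x. (f x - g x)\<^sup>2) \<le> 0" by (rule field_le_epsilon) simp
  moreover have "0 \<le> ?I (\<lambda>x. (f x - g x)\<^sup>2)"
    unfolding set_lebesgue_integral_def by (rule Bochner_Integration.integral_nonneg) simp
  ultimately have "(f x - g x)\<^sup>2 = 0"
    by (intro continuous_nonneg_integral_zero[where h = "\<lambda>x. (f x - g x)\<^sup>2"] x antisym
        continuous_intros f g) auto
  then show ?thesis by simp
qed

text \<open>The decay of the coefficients against the growth \<open>sqrt 2 ^ m\<close> of the level
  sums leaves a factor 2^(-t) per level. The Weierstrass test then gives uniform convergence,
  necessarily to \<open>f\<close>, and the tail from level \<open>N\<close> on is geometric.\<close>

lemma approximation_error:
  assumes f: "continuous_on {0..1} f" and t: "0 < t" and A: "0 \<le> A"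
    and coef: "\<And>m k. k \<in> K m \<Longrightarrow> \<bar>inner01 f (e m k)\<bar> \<le> A * (2 powr - (t + 1 / 2)) ^ m"
    and x: "x \<in> {0..1}"
  shows "\<bar>f x - partial_expansion e K f N x\<bar> \<le> A * D / (1 - 2 powr - t) * (2 powr - t) ^ N"
proof -
  define \<rho> :: real where "\<rho> = 2 powr - t"
  have \<rho>: "0 < \<rho>" "\<rho> < 1" using t by (auto simp: \<rho>_def powr_less_one)
  have root: "2 powr - (t + 1 / 2) * sqrt 2 = \<rho>"
    by (simp add: \<rho>_def powr_half_sqrt[symmetric] powr_add[symmetric])
  define tm where "tm m x = (\<Sum>k\<in>K m. inner01 f (e m k) * e m k x)" for m x
  have bound: "norm (tm m x) \<le> A * D * \<rho> ^ m" if "x \<in> {0..1}" for m x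
    using level_sum_le[OF that coef] A unfolding tm_def root[symmetric] power_mult_distrib
    by (simp add: mult_ac)
  have geo: "(\<lambda>m. A * D * \<rho> ^ (m + N)) sums (A * D * \<rho> ^ N / (1 - \<rho>))" for N
    using sums_mult[OF geometric_sums[of \<rho>], of "A * D * \<rho> ^ N"] \<rho> by (simp add: power_add mult_ac)
  have lim: "uniform_limit {0..1} (partial_expansion e K f) (\<lambda>x. \<Sum>m. tm m x) sequentially"
    unfolding partial_expansion_def tm_def[symmetric]
    by (rule Weierstrass_m_test[OF bound]) (use geo[of 0] in \<open>auto simp: sums_iff\<close>)
  have summ: "summable (\<lambda>m. tm m x)"
    by (rule summable_comparison_test'[OF _ bound[OF x]]) (use geo[of 0] in \<open>auto simp: sums_iff\<close>)
  have "f x - partial_expansion e K f N x = (\<Sum>m. tm (m + N) x)"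
    using uniform_limit_eq[OF f lim x] suminf_split_initial_segment[OF summ, of N]
    by (simp add: partial_expansion_def tm_def)
  also have "\<bar>\<dots>\<bar> \<le> (\<Sum>m. A * D * \<rho> ^ (m + N))"
    using geo[of N] bound[OF x] by (intro norm_suminf_le[where 'a = real, unfolded real_norm_def]) (auto simp: sums_iff)
  also have "\<dots> = A * D * \<rho> ^ N / (1 - \<rho>)" using geo[of N] by (simp add: sums_iff)
  finally show ?thesis by (simp add: \<rho>_def)
qed

end

section \<open>Exponential inequalities for empirical means\<close>

definition cont_density01 :: "(real \<Rightarrow> real) \<Rightarrow> bool" where
  "cont_density01 f \<longleftrightarrow> continuous_on {0..1} f \<and> (\<forall>x\<in>{0..1}. 0 \<le> f x) \<and>
     (LINT x:{0..1}|lborel. f x) = 1"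

definition density_law :: "(real \<Rightarrow> real) \<Rightarrow> real measure" where
  "density_law f = density (restrict_space lborel {0..1}) (\<lambda>x. ennreal (f x))"

lemma joint_law_eq: "joint_law f n = PiM {1..n} (\<lambda>_. density_law f)"
  by (simp add: joint_law_def density_law_def)

lemma sets_density_law [measurable_cong]:
  "sets (density_law f) = sets (restrict_space borel {0..1})"
  by (simp add: density_law_def cong: sets_restrict_space_cong)

lemma sets_joint_law: "sets (joint_law f n) = sets (sample_space n)"
  unfolding joint_law_eq sample_space_def by (intro sets_PiM_cong sets_density_law) simp

lemma space_joint_law: "space (joint_law f n) = space (sample_space n)"
  by (rule sets_eq_imp_space_eq[OF sets_joint_law])

lemma continuous_measurable01:
  "continuous_on {0..1} h \<Longrightarrow> h \<in> borel_measurable (restrict_space borel {0..1::real})"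
  by (rule borel_measurable_continuous_on_restrict)

text \<open>Passes from the nonnegative integral, natural for product measures, to the real integral
  over the unit interval in which coefficients are defined.\<close>

lemma nn_integral_density_law:
  assumes f: "continuous_on {0..1} f" "\<And>x. x \<in> {0..1} \<Longrightarrow> 0 \<le> f x"
    and h: "continuous_on {0..1} h" "\<And>x. x \<in> {0..1} \<Longrightarrow> 0 \<le> h x"
  shows "(\<integral>\<^sup>+ x. ennreal (h x) \<partial>density_law f) = ennreal (LINT x:{0..1}|lborel. f x * h x)"
proof -
  have meas: "u \<in> borel_measurable (restrict_space lborel {0..1})" if "continuous_on {0..1} u" for u :: "real \<Rightarrow> real"
    using continuous_measurable01[OF that]
    by (subst measurable_cong_sets[OF sets_restrict_space_cong[OF sets_lborel] refl])
  have "(\<integral>\<^sup>+ x. ennreal (h x) \<partial>density_law f) =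
      (\<integral>\<^sup>+ x. ennreal (f x) * ennreal (h x) \<partial>restrict_space lborel {0..1})"
    unfolding density_law_def
    by (rule nn_integral_density) (auto intro!: measurable_compose[OF meas] f h)
  also have "\<dots> = (\<integral>\<^sup>+ x. ennreal (f x * h x) * indicator {0..1} x \<partial>lborel)"
    by (subst nn_integral_restrict_space)
       (auto intro!: nn_integral_cong simp: ennreal_mult f h split: split_indicator)
  also have "\<dots> = (\<integral>\<^sup>+ x. ennreal (indicator {0..1} x * (f x * h x)) \<partial>lborel)"
    by (auto intro!: nn_integral_cong split: split_indicator)
  also have "\<dots> = ennreal (LINT x:{0..1}|lborel. f x * h x)"
    unfolding set_lebesgue_integral_def real_scaleR_def
  proof (rule nn_integral_eq_integral)
    show "integrable lborel (\<lambda>x. indicator {0..1} x * (f x * h x))"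
      using borel_integrable_atLeastAtMost'[of 0 1 "\<lambda>x. f x * h x"] f h
      by (auto simp: set_integrable_def intro!: continuous_intros)
  qed (auto simp: f h split: split_indicator)
  finally show ?thesis .
qed

lemma prob_space_density_law: "cont_density01 f \<Longrightarrow> prob_space (density_law f)"
  using nn_integral_density_law[of f "\<lambda>_. 1"]
  by (intro prob_spaceI) (simp add: cont_density01_def)

lemma prob_space_joint_law: "cont_density01 f \<Longrightarrow> prob_space (joint_law f n)"
  unfolding joint_law_eq by (intro prob_space_PiM prob_space_density_law)

section \<open>Empirical means and Chernoff bounds\<close>

definition emp_mean :: "(real \<Rightarrow> real) \<Rightarrow> nat \<Rightarrow> (nat \<Rightarrow> real) \<Rightarrow> real" where
  "emp_mean g n X = (\<Sum>i\<in>{1..n}. g (X i)) / real n"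

lemma emp_mean_measurable:
  assumes "continuous_on {0..1} g"
  shows "emp_mean g n \<in> borel_measurable (sample_space n)"
proof -
  note continuous_measurable01[OF assms, measurable]
  show ?thesis
    unfolding emp_mean_def sample_space_def by measurable
qed

text \<open>For negative \<open>x\<close>, the inequality exp(-x) \<ge> 1 - x gives exp x * (1 - x)
  \<le> 1, while (1 + x + x^2)(1 - x) = 1 - x^3 \<ge> 1.\<close>

lemma exp_le_quadratic:
  fixes x :: real
  assumes "\<bar>x\<bar> \<le> 1"
  shows "exp x \<le> 1 + x + x\<^sup>2"
proof (cases "0 \<le> x")
  case True
  then show ?thesis using assms by (intro exp_bound) auto
next
  case False
  have "exp x * exp (- x) = 1" by (simp add: exp_minus)
  moreover have "exp x * (1 - x) \<le> exp x * exp (- x)"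
    using exp_ge_add_one_self[of "- x"] by (intro mult_left_mono) auto
  ultimately have "exp x * (1 - x) \<le> 1" by simp
  also have "1 \<le> (1 + x + x\<^sup>2) * (1 - x)"
  proof -
    have "(1 + x + x\<^sup>2) * (1 - x) = 1 + x\<^sup>2 * (- x)"
      by (simp add: power2_eq_square algebra_simps)
    then show ?thesis using False by (simp add: mult_nonneg_nonpos)
  qed
  finally show ?thesis using False by (simp add: mult_le_cancel_right)
qed

text \<open>Markov's inequality for the product of exp(\<kappa> (g(X_i) - \<theta> - t)), where
  \<theta> is the mean of \<open>g\<close>; by independence its expectation is an n-th power. The
  condition on \<kappa> makes the quadratic bound for exp available, and \<kappa> stays free to be
  tuned later.\<close>

lemma chernoff_upper:
  assumes f: "cont_density01 f" and g: "continuous_on {0..1} g"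
    and lam: "0 \<le> \<kappa>" "\<And>x. x \<in> {0..1} \<Longrightarrow> \<kappa> * \<bar>g x\<bar> \<le> 1"
    and var: "(LINT x:{0..1}|lborel. f x * (g x)\<^sup>2) \<le> V" and n: "0 < n"
  shows "measure (joint_law f n) {X \<in> space (joint_law f n). t \<le> emp_mean g n X - inner01 f g}
         \<le> exp (- real n * (\<kappa> * t - \<kappa>\<^sup>2 * V))"
proof -
  interpret product_sigma_finite "\<lambda>_. density_law f"
    by (intro product_sigma_finite.intro prob_space_imp_sigma_finite prob_space_density_law f)
  interpret P: prob_space "joint_law f n" by (rule prob_space_joint_law[OF f])
  note f' = f[unfolded cont_density01_def]
  let ?\<theta> = "inner01 f g"
  define h where "h x = exp (\<kappa> * (g x - ?\<theta> - t))" for x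
  have h: "continuous_on {0..1} h" unfolding h_def by (intro continuous_intros g)
  have h_le: "h x \<le> exp (- \<kappa> * (?\<theta> + t)) * (1 + \<kappa> * g x + \<kappa>\<^sup>2 * (g x)\<^sup>2)" if "x \<in> {0..1}" for x
  proof -
    have "h x = exp (- \<kappa> * (?\<theta> + t)) * exp (\<kappa> * g x)"
      by (simp add: h_def exp_add[symmetric] algebra_simps)
    also have "\<dots> \<le> exp (- \<kappa> * (?\<theta> + t)) * (1 + \<kappa> * g x + (\<kappa> * g x)\<^sup>2)"
      using lam that by (intro mult_left_mono exp_le_quadratic) (auto simp: abs_mult)
    finally show ?thesis by (simp add: power_mult_distrib)
  qed
  have "(LINT x:{0..1}|lborel. f x * h x) \<le>
      (LINT x:{0..1}|lborel. exp (- \<kappa> * (?\<theta> + t)) * (f x + \<kappa> * (f x * g x) + \<kappa>\<^sup>2 * (f x * (g x)\<^sup>2)))"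
  proof (rule set_integral_mono)
    fix x :: real assume x: "x \<in> {0..1}"
    have "f x * h x \<le> f x * (exp (- \<kappa> * (?\<theta> + t)) * (1 + \<kappa> * g x + \<kappa>\<^sup>2 * (g x)\<^sup>2))"
      using h_le[OF x] f' x by (intro mult_left_mono) auto
    then show "f x * h x \<le> exp (- \<kappa> * (?\<theta> + t)) * (f x + \<kappa> * (f x * g x) + \<kappa>\<^sup>2 * (f x * (g x)\<^sup>2))"
      by (simp add: algebra_simps)
  qed (use f' h g in \<open>auto intro!: borel_integrable_atLeastAtMost' continuous_intros\<close>)
  also have "\<dots> = exp (- \<kappa> * (?\<theta> + t)) * (1 + \<kappa> * ?\<theta> + \<kappa>\<^sup>2 * (LINT x:{0..1}|lborel. f x * (g x)\<^sup>2))"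
  proof -
    have "(LINT x:{0..1}|lborel. f x + \<kappa> * (f x * g x) + \<kappa>\<^sup>2 * (f x * (g x)\<^sup>2)) =
       (LINT x:{0..1}|lborel. f x) + \<kappa> * ?\<theta> + \<kappa>\<^sup>2 * (LINT x:{0..1}|lborel. f x * (g x)\<^sup>2)"
      using f' g
      by (subst set_integral_add(2), auto intro!: borel_integrable_atLeastAtMost' continuous_intros)
         (subst set_integral_add(2), auto intro!: borel_integrable_atLeastAtMost' continuous_intros simp: inner01_def)
    then show ?thesis using f' by simp
  qed
  \<comment> \<open>1 + u \<le> exp u; the mean term in the exponent then cancels against the
    prefactor.\<close>
  also have "\<dots> \<le> exp (- \<kappa> * (?\<theta> + t)) * exp (\<kappa> * ?\<theta> + \<kappa>\<^sup>2 * V)"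
    using var exp_ge_add_one_self[of "\<kappa> * ?\<theta> + \<kappa>\<^sup>2 * V"] mult_left_mono[OF var zero_le_power2[of \<kappa>]]
    by (intro mult_left_mono) (linarith, simp)
  also have "\<dots> = exp (- (\<kappa> * t - \<kappa>\<^sup>2 * V))"
    by (simp add: exp_add[symmetric] algebra_simps)
  finally have one: "(\<integral>\<^sup>+ x. ennreal (h x) \<partial>density_law f) \<le> ennreal (exp (- (\<kappa> * t - \<kappa>\<^sup>2 * V)))"
    using f' h by (subst nn_integral_density_law) (auto simp: h_def intro!: ennreal_leI)
  have h_meas: "(\<lambda>x. ennreal (h x)) \<in> borel_measurable (density_law f)"
    by (rule measurable_compose[OF _ measurable_ennreal])
       (use continuous_measurable01[OF h] in \<open>simp add: measurable_cong_sets[OF sets_density_law refl]\<close>)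
  have "emeasure (joint_law f n) {X \<in> space (joint_law f n). t \<le> emp_mean g n X - ?\<theta>} \<le>
        emeasure (joint_law f n) {X \<in> space (joint_law f n). 1 \<le> 1 * (\<Prod>i\<in>{1..n}. ennreal (h (X i)))}"
  proof (rule emeasure_mono)
    show "{X \<in> space (joint_law f n). t \<le> emp_mean g n X - ?\<theta>} \<subseteq>
        {X \<in> space (joint_law f n). 1 \<le> 1 * (\<Prod>i\<in>{1..n}. ennreal (h (X i)))}"
    proof safe
      fix X assume "t \<le> emp_mean g n X - ?\<theta>"
      then have "0 \<le> \<kappa> * (\<Sum>i\<in>{1..n}. g (X i) - ?\<theta> - t)"
        using n lam(1) by (intro mult_nonneg_nonneg) (auto simp: emp_mean_def sum_subtractf field_simps)
      then have "1 \<le> exp (\<Sum>i\<in>{1..n}. \<kappa> * (g (X i) - ?\<theta> - t))"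
        by (simp add: sum_distrib_left)
      then have "1 \<le> (\<Prod>i\<in>{1..n}. h (X i))" by (simp add: exp_sum h_def)
      then show "1 \<le> 1 * (\<Prod>i\<in>{1..n}. ennreal (h (X i)))"
        by (subst prod_ennreal) (auto simp: h_def)
    qed
    show "{X \<in> space (joint_law f n). 1 \<le> 1 * (\<Prod>i\<in>{1..n}. ennreal (h (X i)))} \<in> sets (joint_law f n)"
      unfolding joint_law_eq using h_meas by measurable
  qed
  also have "\<dots> \<le> 1 * (\<integral>\<^sup>+ X. (\<Prod>i\<in>{1..n}. ennreal (h (X i))) * indicator (space (joint_law f n)) X \<partial>joint_law f n)"
    by (rule nn_integral_Markov_inequality) (use h_meas in \<open>unfold joint_law_eq, measurable\<close>)
  also have "\<dots> = (\<integral>\<^sup>+ X. (\<Prod>i\<in>{1..n}. ennreal (h (X i))) \<partial>joint_law f n)"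
    by (auto intro!: nn_integral_cong)
  also have "\<dots> = (\<integral>\<^sup>+ x. ennreal (h x) \<partial>density_law f) ^ n"
    unfolding joint_law_eq by (subst product_nn_integral_prod) (auto simp: h_meas)
  also have "\<dots> \<le> ennreal (exp (- (\<kappa> * t - \<kappa>\<^sup>2 * V))) ^ n"
    by (intro power_mono one) simp
  also have "\<dots> = ennreal (exp (- real n * (\<kappa> * t - \<kappa>\<^sup>2 * V)))"
    by (simp add: ennreal_power exp_of_nat_mult[symmetric] algebra_simps)
  finally show ?thesis
    by (simp add: P.emeasure_eq_measure)
qed

text \<open>Union bound over the one-sided inequality for \<open>g\<close> and for
  \<open>- g\<close>, which share the second moment bound and the condition on \<kappa>.\<close>

lemma chernoff_two_sided:
  assumes f: "cont_density01 f" and g: "continuous_on {0..1} g"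
    and lam: "0 \<le> \<kappa>" "\<And>x. x \<in> {0..1} \<Longrightarrow> \<kappa> * \<bar>g x\<bar> \<le> 1"
    and var: "(LINT x:{0..1}|lborel. f x * (g x)\<^sup>2) \<le> V" and n: "0 < n"
  shows "measure (joint_law f n) {X \<in> space (joint_law f n). \<not> \<bar>emp_mean g n X - inner01 f g\<bar> \<le> t}
         \<le> 2 * exp (- real n * (\<kappa> * t - \<kappa>\<^sup>2 * V))"
proof -
  interpret P: prob_space "joint_law f n" by (rule prob_space_joint_law[OF f])
  let ?U = "\<lambda>g. {X \<in> space (joint_law f n). t \<le> emp_mean g n X - inner01 f g}"
  have sets: "?U u \<in> sets (joint_law f n)" if "continuous_on {0..1} u" for u
    using emp_mean_measurable[OF that, of n]
    unfolding space_joint_law sets_joint_law by measurable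
  have g': "continuous_on {0..1} (\<lambda>x. - g x)" by (intro continuous_intros g)
  have neg: "emp_mean (\<lambda>x. - g x) n X = - emp_mean g n X" "inner01 f (\<lambda>x. - g x) = - inner01 f g" for X
    by (simp_all add: emp_mean_def inner01_def sum_negf set_lebesgue_integral_def)
  have "measure (joint_law f n) {X \<in> space (joint_law f n). \<not> \<bar>emp_mean g n X - inner01 f g\<bar> \<le> t}
      \<le> measure (joint_law f n) (?U g \<union> ?U (\<lambda>x. - g x))"
    by (rule P.finite_measure_mono) (use sets[OF g] sets[OF g'] in \<open>auto simp: neg\<close>)
  also have "\<dots> \<le> measure (joint_law f n) (?U g) + measure (joint_law f n) (?U (\<lambda>x. - g x))"
    by (intro measure_Un_le sets g g')
  also have "\<dots> \<le> 2 * exp (- real n * (\<kappa> * t - \<kappa>\<^sup>2 * V))"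
    using chernoff_upper[OF f g lam var n, of t] chernoff_upper[OF f g', of \<kappa> V n t] lam var n by auto
  finally show ?thesis .
qed

section \<open>Resolution levels and rates\<close>

text \<open>The resolution that balances bias and noise at smoothness \<open>t\<close>: 2^J is of
  order (n / log n)^(1/(2t+1)). The value \<open>t = 0\<close> gives the finest resolution at which
  coefficients are estimated reliably.\<close>

definition level :: "real \<Rightarrow> nat \<Rightarrow> nat" where
  "level t n = nat \<lfloor>log 2 (real n / ln (real n)) / (2 * t + 1)\<rfloor>"

text \<open>Rests on e \<le> 3, and is the source of the condition \<open>3 \<le> n\<close> in what
  follows.\<close>

lemma ln_ge_1: "3 \<le> n \<Longrightarrow> 1 \<le> ln (real n)"
  using exp_le by (subst ln_ge_iff) auto

lemma ratio_ge_1: "3 \<le> n \<Longrightarrow> 1 \<le> real n / ln (real n)"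
  using ln_ge_1[of n] ln_bound[of "real n"] by (simp add: field_simps)

lemma level_bounds:
  assumes "3 \<le> n" "0 \<le> t"
  shows "2 ^ level t n \<le> (real n / ln (real n)) powr (1 / (2 * t + 1))"
    and "(real n / ln (real n)) powr (1 / (2 * t + 1)) \<le> 2 * 2 ^ level t n"
proof -
  define R where "R = real n / ln (real n)"
  define u where "u = log 2 R / (2 * t + 1)"
  have R: "1 \<le> R" using ratio_ge_1[OF assms(1)] by (simp add: R_def)
  then have u: "0 \<le> u" using assms by (simp add: u_def)
  have R_powr: "R powr (1 / (2 * t + 1)) = 2 powr u"
    using R by (simp add: u_def powr_def log_def)
  have level: "real (level t n) \<le> u" "u \<le> real (level t n) + 1"
    using u by (simp_all add: level_def u_def R_def)
  show "2 ^ level t n \<le> (real n / ln (real n)) powr (1 / (2 * t + 1))"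
    unfolding R_def[symmetric] R_powr using level by (simp add: powr_realpow[symmetric])
  have "2 powr u \<le> 2 powr (real (level t n) + 1)" using level by simp
  then show "(real n / ln (real n)) powr (1 / (2 * t + 1)) \<le> 2 * 2 ^ level t n"
    unfolding R_def[symmetric] R_powr by (simp add: powr_add powr_realpow)
qed

lemma rate_eq: "3 \<le> n \<Longrightarrow> rate t n = (real n / ln (real n)) powr - (t / (2 * t + 1))"
  using ln_ge_1[of n] by (simp add: rate_def powr_divide powr_minus field_simps)

lemma rate_nonneg [simp]: "0 \<le> rate t n"
  by (simp add: rate_def)

lemma level_mono:
  assumes "3 \<le> n" "0 \<le> t"
  shows "level t n \<le> level 0 n"
proof -
  have "0 \<le> log 2 (real n / ln (real n))" using ratio_ge_1[OF assms(1)] by simp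
  then show ?thesis
    using assms by (auto simp: level_def intro!: nat_mono floor_mono divide_left_mono[of 1, simplified])
qed

text \<open>The exponent t/(2t+1) increases with t, and its base (log n)/n is at most 1.\<close>

lemma rate_antimono:
  assumes "3 \<le> n" "0 \<le> r" "r \<le> s"
  shows "rate s n \<le> rate r n"
proof -
  have "r / (2 * r + 1) \<le> s / (2 * s + 1)"
    using assms by (simp add: divide_simps) (simp add: algebra_simps)
  then show ?thesis using ratio_ge_1[OF assms(1)] assms(1)
    by (simp add: rate_eq powr_mono)
qed

lemma rate_le_1: "3 \<le> n \<Longrightarrow> 0 \<le> t \<Longrightarrow> rate t n \<le> 1"
  using rate_antimono[of n 0 t] by (simp add: rate_def split: if_splits)

text \<open>Lets the contribution of the exceptional event be absorbed into the rate: the exponent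
  t/(2t+1) is at most 1 and log n \<ge> 1.\<close>

lemma rate_ge:
  assumes "3 \<le> n" "0 \<le> t"
  shows "1 / real n \<le> rate t n"
proof -
  have "1 / real n \<le> ln (real n) / real n" using ln_ge_1[OF assms(1)] by (simp add: divide_right_mono)
  also have "\<dots> = (real n / ln (real n)) powr - 1"
    using ln_ge_1[OF assms(1)] assms(1) by (simp add: powr_minus_divide)
  also have "\<dots> \<le> rate t n"
    unfolding rate_eq[OF assms(1)]
    by (rule powr_mono) (use assms ratio_ge_1[OF assms(1)] in \<open>auto simp: divide_simps\<close>)
  finally show ?thesis .
qed

text \<open>The factor \<open>2 powr t\<close> pays for rounding the resolution down to an
  integer.\<close>

lemma level_bias:
  assumes "3 \<le> n" "0 \<le> t"
  shows "(2 powr - t) ^ level t n \<le> 2 powr t * rate t n"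
proof -
  define R where "R = real n / ln (real n)"
  have R: "0 < R" using ratio_ge_1[OF assms(1)] by (simp add: R_def)
  have "(2 powr - t) ^ level t n = (2 ^ level t n) powr - t"
    by (simp add: powr_realpow[symmetric] powr_powr mult.commute)
  also have "\<dots> \<le> (R powr (1 / (2 * t + 1)) / 2) powr - t"
    using level_bounds(2)[OF assms] R assms by (intro powr_mono2') (auto simp: R_def)
  also have "\<dots> = 2 powr t * rate t n"
    using R assms by (simp add: rate_eq R_def[symmetric] powr_divide powr_powr powr_minus divide_simps)
  finally show ?thesis .
qed

text \<open>The exponents of n / log n add up to 1/(2(2t+1)) - 1/2 = -t/(2t+1).\<close>

lemma level_noise:
  assumes "3 \<le> n" "0 \<le> t"
  shows "sqrt 2 ^ level t n * sqrt (ln (real n) / real n) \<le> rate t n"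
proof -
  define R where "R = real n / ln (real n)"
  have R: "0 < R" using ratio_ge_1[OF assms(1)] by (simp add: R_def)
  have "sqrt (2 ^ level t n) \<le> sqrt (R powr (1 / (2 * t + 1)))"
    using level_bounds(1)[OF assms] by (simp add: R_def)
  also have "\<dots> = R powr (1 / (2 * t + 1) / 2)"
    using R by (simp add: powr_half_sqrt[symmetric] powr_powr)
  finally have 1: "sqrt 2 ^ level t n \<le> R powr (1 / (2 * t + 1) / 2)"
    by (simp add: real_sqrt_power)
  have "sqrt (ln (real n) / real n) = sqrt (1 / R)" by (simp add: R_def)
  also have "\<dots> = R powr - (1 / 2)"
    using R by (simp add: powr_minus powr_half_sqrt real_sqrt_inverse inverse_eq_divide real_sqrt_divide)
  finally have 2: "sqrt (ln (real n) / real n) = R powr - (1 / 2)" .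
  have "sqrt 2 ^ level t n * sqrt (ln (real n) / real n) \<le> R powr (1 / (2 * t + 1) / 2) * R powr - (1 / 2)"
    unfolding 2 by (intro mult_right_mono 1) simp
  also have "\<dots> = R powr (1 / (2 * t + 1) / 2 + - (1 / 2))"
    by (simp add: powr_add[symmetric])
  also have "1 / (2 * t + 1) / 2 + - (1 / 2) = - (t / (2 * t + 1))"
    using assms by (simp add: field_simps)
  finally show ?thesis using assms by (simp add: rate_eq R_def)
qed

text \<open>Guarantees that any fixed coefficient is eventually among those tested.\<close>

lemma level_0_at_top: "filterlim (level 0) at_top sequentially"
proof -
  have "filterlim (\<lambda>n. log 2 (real n / ln (real n))) at_top sequentially"
    by real_asymp
  then have "filterlim (\<lambda>n. nat \<lfloor>log 2 (real n / ln (real n))\<rfloor>) at_top sequentially"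
    by (intro filterlim_compose[OF filterlim_nat_sequentially] filterlim_compose[OF filterlim_floor_sequentially])
  then show ?thesis by (simp add: level_def[abs_def])
qed

section \<open>The linear wavelet estimator\<close>

definition (in wavelet_system) estimator :: "nat \<Rightarrow> nat \<Rightarrow> (nat \<Rightarrow> real) \<Rightarrow> real \<Rightarrow> real" where
  "estimator n J X y = (\<Sum>m<J. \<Sum>k\<in>K m. emp_mean (e m k) n X * e m k y)"

text \<open>The event of simultaneous accuracy below level \<open>N\<close>; on it the estimation
  bounds are deterministic.\<close>

definition (in wavelet_system) good_samples :: "(real \<Rightarrow> real) \<Rightarrow> nat \<Rightarrow> nat \<Rightarrow> real \<Rightarrow> (nat \<Rightarrow> real) set" where
  "good_samples f n N \<delta> = {X \<in> space (sample_space n).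
     \<forall>m<N. \<forall>k\<in>K m. \<bar>emp_mean (e m k) n X - inner01 f (e m k)\<bar> \<le> \<delta>}"

context wavelet_system begin

lemma emp_mean_e_measurable [measurable]:
  "k \<in> K m \<Longrightarrow> emp_mean (e m k) n \<in> borel_measurable (sample_space n)"
  by (intro emp_mean_measurable cont)

lemma estimator_measurable [measurable]: "(\<lambda>X. estimator n J X y) \<in> borel_measurable (sample_space n)"
  unfolding estimator_def by measurable

lemma continuous_estimator: "continuous_on {0..1} (estimator n J X)"
  unfolding estimator_def by (intro continuous_intros cont)

lemma good_samples_sets [measurable]: "good_samples f n N \<delta> \<in> sets (sample_space n)"
proof -
  have "good_samples f n N \<delta> = {X \<in> space (sample_space n).
     \<forall>m\<in>{..<N}. \<forall>k\<in>K m. \<bar>emp_mean (e m k) n X - inner01 f (e m k)\<bar> \<le> \<delta>}"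
    by (auto simp: good_samples_def)
  also have "\<dots> \<in> sets (sample_space n)"
    by (intro sets.sets_Collect_finite_All) measurable
  finally show ?thesis .
qed

lemma Q_nonneg: "0 \<le> Q"
  using card_K[of 0] of_nat_0_le_iff[of "card (K 0)"] by simp

text \<open>Since the basis functions have unit norm, the bound on the density keeps their second
  moments bounded uniformly over all levels.\<close>

lemma second_moment_le:
  assumes f: "continuous_on {0..1} f" and F: "\<And>x. x \<in> {0..1} \<Longrightarrow> f x \<le> F" and k: "k \<in> K m"
  shows "(LINT x:{0..1}|lborel. f x * (e m k x)\<^sup>2) \<le> F"
proof -
  have "(LINT x:{0..1}|lborel. f x * (e m k x)\<^sup>2) \<le> (LINT x:{0..1}|lborel. F * (e m k x * e m k x))"
    by (rule set_integral_mono)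
       (auto intro!: borel_integrable_atLeastAtMost' continuous_intros f cont k mult_right_mono F
             simp: power2_eq_square)
  also have "\<dots> = F * inner01 (e m k) (e m k)" by (simp add: inner01_def)
  finally show ?thesis by (simp add: unit k)
qed

text \<open>Union bound over at most \<open>Q * n\<close> coefficients, each failing with
  probability at most 2 n^(-3).\<close>

lemma prob_not_good:
  assumes f: "cont_density01 f" and F: "\<And>x. x \<in> {0..1} \<Longrightarrow> f x \<le> F" "0 \<le> F"
    and n: "3 \<le> n" and N: "2 ^ N \<le> real n / ln (real n)"
  shows "measure (joint_law f n) (space (joint_law f n) -
      good_samples f n N ((3 * D + F) * sqrt (ln (real n) / real n))) \<le> 2 * Q / (real n)\<^sup>2"
proof -
  interpret P: prob_space "joint_law f n" by (rule prob_space_joint_law[OF f])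
  define q where "q = sqrt (ln (real n) / real n)"
  \<comment> \<open>The largest Chernoff parameter with \<open>\<kappa> \<bar>e m k x\<bar> \<le> 1\<close> at every level \<open>m \<le> N\<close>; the summand
    \<open>3 * D\<close> of the threshold then gives probability \<open>n\<^sup>-\<^sup>3\<close> for each of the \<open>O(n)\<close> coefficients.\<close>
  define \<kappa> where "\<kappa> = q / D"
  define \<delta> where "\<delta> = (3 * D + F) * q"
  have ln1: "1 \<le> ln (real n)" by (rule ln_ge_1[OF n])
  have q: "0 < q" "q\<^sup>2 = ln (real n) / real n" using ln1 n by (auto simp: q_def)
  have fc: "continuous_on {0..1} f" using f by (simp add: cont_density01_def)
  let ?I = "SIGMA m:{..<N}. K m"
  let ?bad = "\<lambda>(m, k). {X \<in> space (joint_law f n). \<not> \<bar>emp_mean (e m k) n X - inner01 f (e m k)\<bar> \<le> \<delta>}"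
  \<comment> \<open>The summand \<open>F\<close> of the threshold outweighs the variance term
    \<open>\<kappa>\<^sup>2 * F\<close> because F/D \<ge> F/D^2 for D \<ge> 1. What remains is 3 n
    q^2 = 3 log n.\<close>
  have exponent: "- real n * (\<kappa> * \<delta> - \<kappa>\<^sup>2 * F) \<le> - 3 * ln (real n)"
  proof -
    have "\<kappa> * \<delta> - \<kappa>\<^sup>2 * F = q\<^sup>2 * (3 + (F / D - F / D\<^sup>2))"
      using D_ge_1 by (simp add: \<kappa>_def \<delta>_def power2_eq_square field_simps)
    also have "\<dots> \<ge> q\<^sup>2 * 3"
      using D_ge_1 F(2) mult_left_mono[of 1 D F]
      by (intro mult_left_mono) (auto simp: power2_eq_square divide_simps)
    finally have "ln (real n) * 3 \<le> real n * (\<kappa> * \<delta> - \<kappa>\<^sup>2 * F)"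
      using n by (simp add: q field_simps)
    then show ?thesis by simp
  qed
  have single: "measure (joint_law f n) (?bad i) \<le> 2 / real n ^ 3" if I: "i \<in> ?I" for i
  proof -
    obtain m k where i: "i = (m, k)" "m < N" "k \<in> K m" using I by (elim SigmaE) auto
    have small: "\<kappa> * \<bar>e m k x\<bar> \<le> 1" if x: "x \<in> {0..1}" for x
    proof -
      have "sqrt 2 ^ m \<le> sqrt 2 ^ N" using i by (intro power_increasing) auto
      also have "\<dots> = sqrt (2 ^ N)" by (simp add: real_sqrt_power)
      also have "\<dots> \<le> sqrt (real n / ln (real n))" using N by simp
      also have "\<dots> = 1 / q" by (simp add: q_def real_sqrt_divide)
      finally have "q * sqrt 2 ^ m \<le> 1" using q by (simp add: field_simps)
      moreover have "\<kappa> * \<bar>e m k x\<bar> \<le> \<kappa> * (D * sqrt 2 ^ m)"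
        using abs_le[OF i(3) x] q D_ge_1 by (intro mult_left_mono) (auto simp: \<kappa>_def)
      moreover have "\<kappa> * (D * sqrt 2 ^ m) = q * sqrt 2 ^ m" using D_ge_1 by (simp add: \<kappa>_def)
      ultimately show ?thesis by simp
    qed
    have "measure (joint_law f n) (?bad i) \<le> 2 * exp (- real n * (\<kappa> * \<delta> - \<kappa>\<^sup>2 * F))"
      unfolding i prod.case
      by (rule chernoff_two_sided[OF f cont[OF i(3)] _ small second_moment_le[OF fc F(1) i(3)]])
         (use n q D_ge_1 in \<open>auto simp: \<kappa>_def\<close>)
    also have "\<dots> \<le> 2 * exp (- 3 * ln (real n))" using exponent by simp
    also have "exp (- 3 * ln (real n)) = 1 / real n ^ 3"
      using n exp_of_nat_mult[of 3 "ln (real n)"] by (simp add: exp_minus inverse_eq_divide)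
    finally show ?thesis by simp
  qed
  have "real (card ?I) = (\<Sum>m<N. real (card (K m)))" by (simp add: card_SigmaI)
  also have "\<dots> \<le> (\<Sum>m<N. Q * 2 ^ m)" by (intro sum_mono card_K)
  also have "\<dots> = Q * (2 ^ N - 1)" by (subst sum_distrib_left[symmetric], subst geometric_sum) auto
  also have "\<dots> \<le> Q * real n"
  proof (rule mult_left_mono[OF _ Q_nonneg])
    have "real n / ln (real n) \<le> real n" using ln1 n by (simp add: field_simps)
    then show "2 ^ N - 1 \<le> real n" using N by linarith
  qed
  finally have card: "real (card ?I) \<le> Q * real n" .
  have "measure (joint_law f n) (space (joint_law f n) - good_samples f n N \<delta>) = measure (joint_law f n) (\<Union>i\<in>?I. ?bad i)"
    by (rule arg_cong[where f = "measure _"]) (auto simp: good_samples_def space_joint_law)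
  also have "\<dots> \<le> (\<Sum>i\<in>?I. measure (joint_law f n) (?bad i))"
  proof (rule P.finite_measure_subadditive_finite)
    show "?bad ` ?I \<subseteq> sets (joint_law f n)"
      unfolding sets_joint_law space_joint_law by (auto; measurable)
  qed simp
  also have "\<dots> \<le> (\<Sum>i\<in>?I. 2 / real n ^ 3)" by (intro sum_mono single)
  also have "\<dots> = real (card ?I) * (2 / real n ^ 3)" by simp
  also have "\<dots> \<le> (Q * real n) * (2 / real n ^ 3)" by (intro mult_right_mono card) simp
  also have "\<dots> = 2 * Q / (real n)\<^sup>2" using n by (simp add: power2_eq_square power3_eq_cube)
  finally show ?thesis by (simp add: \<delta>_def q_def)
qed

text \<open>Level \<open>m\<close> contributes at most \<open>\<delta> * D * sqrt 2 ^ m\<close>;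
  summing the geometric series costs only the factor 1/(sqrt 2 - 1).\<close>

lemma estimation_error:
  assumes X: "X \<in> good_samples f n N \<delta>" and J: "J \<le> N" and x: "x \<in> {0..1}" and \<delta>: "0 \<le> \<delta>"
  shows "\<bar>estimator n J X x - partial_expansion e K f J x\<bar> \<le> \<delta> * D / (sqrt 2 - 1) * sqrt 2 ^ J"
proof -
  have sqrt2: "1 < sqrt (2::real)" by simp
  have "estimator n J X x - partial_expansion e K f J x =
      (\<Sum>m<J. \<Sum>k\<in>K m. (emp_mean (e m k) n X - inner01 f (e m k)) * e m k x)"
    by (simp add: estimator_def partial_expansion_def sum_subtractf left_diff_distrib)
  also have "\<bar>\<dots>\<bar> \<le> (\<Sum>m<J. \<delta> * D * sqrt 2 ^ m)"
    by (rule order_trans[OF sum_abs])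
       (use X J in \<open>auto intro!: sum_mono level_sum_le x \<delta> simp: good_samples_def\<close>)
  also have "\<dots> = \<delta> * D * ((sqrt 2 ^ J - 1) / (sqrt 2 - 1))"
    by (subst sum_distrib_left[symmetric], subst geometric_sum) auto
  also have "\<dots> \<le> \<delta> * D * (sqrt 2 ^ J / (sqrt 2 - 1))"
    using \<delta> D_ge_1 sqrt2 by (intro mult_left_mono divide_right_mono) auto
  finally show ?thesis by (simp add: mult_ac)
qed

text \<open>Bias plus noise at the balancing resolution. The good event is taken at
  \<open>level 0 n\<close> for every \<open>t\<close>, so that one event serves both smoothness
  indices.\<close>

lemma estimator_rate:
  assumes f: "continuous_on {0..1} f" and t: "0 < t" and A: "0 \<le> A"
    and coef: "\<And>m k. k \<in> K m \<Longrightarrow> \<bar>inner01 f (e m k)\<bar> \<le> A * (2 powr - (t + 1 / 2)) ^ m"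
    and n: "3 \<le> n" and C: "0 \<le> C" and x: "x \<in> {0..1}"
    and X: "X \<in> good_samples f n (level 0 n) (C * sqrt (ln (real n) / real n))"
  shows "\<bar>f x - estimator n (level t n) X x\<bar>
     \<le> (A * D / (1 - 2 powr - t) * 2 powr t + C * D / (sqrt 2 - 1)) * rate t n"
proof -
  have sqrt2: "1 < sqrt (2::real)" by simp
  have "2 powr - t < 1" using t by (auto simp: powr_less_one)
  let ?J = "level t n"
  have "\<bar>f x - partial_expansion e K f ?J x\<bar> \<le> A * D / (1 - 2 powr - t) * (2 powr - t) ^ ?J"
    by (rule approximation_error[OF f t A coef x])
  also have "\<dots> \<le> A * D / (1 - 2 powr - t) * (2 powr t * rate t n)"
    using A D_ge_1 \<open>2 powr - t < 1\<close> t by (intro mult_left_mono level_bias n) auto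
  finally have bias: "\<bar>f x - partial_expansion e K f ?J x\<bar> \<le> \<dots>" .
  have "\<bar>estimator n ?J X x - partial_expansion e K f ?J x\<bar> \<le>
      C * sqrt (ln (real n) / real n) * D / (sqrt 2 - 1) * sqrt 2 ^ ?J"
    using C ln_ge_1[OF n] by (intro estimation_error[OF X] level_mono n x) (auto simp: t less_imp_le)
  also have "\<dots> = C * D / (sqrt 2 - 1) * (sqrt 2 ^ ?J * sqrt (ln (real n) / real n))" by simp
  also have "\<dots> \<le> C * D / (sqrt 2 - 1) * rate t n"
    using C D_ge_1 sqrt2 t by (intro mult_left_mono level_noise n) auto
  finally have "\<bar>estimator n ?J X x - partial_expansion e K f ?J x\<bar> \<le> C * D / (sqrt 2 - 1) * rate t n" .
  with bias show ?thesis by (simp add: algebra_simps)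
qed

end

section \<open>The adaptive band\<close>

text \<open>Reduces the coverage event, an uncountable intersection, to a measurable one.\<close>

lemma continuous_all_le_iff_rat:
  fixes h :: "real \<Rightarrow> real"
  assumes h: "continuous_on {0..1} h"
  shows "(\<forall>y\<in>{0..1}. h y \<le> w) \<longleftrightarrow> (\<forall>q\<in>{0<..<1::rat}. h (of_rat q) \<le> w)"
proof
  assume rat: "\<forall>q\<in>{0<..<1::rat}. h (of_rat q) \<le> w"
  have dense: "closure ({0<..<1} \<inter> \<rat>) = {0..1::real}"
    using closure_open_Int_superset[of "{0<..<1::real}" \<rat>] by (simp add: Rats_closure_real)
  have le: "h y \<le> w" if "y \<in> {0<..<1} \<inter> \<rat>" for y
    using that rat by (auto elim!: Rats_cases)
  show "\<forall>y\<in>{0..1}. h y \<le> w"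
    using continuous_le_on_closure[of "{0<..<1} \<inter> \<rat>" h _ w, unfolded dense, OF h _ le] by blast
qed auto

lemma ennreal_bigoI:
  assumes "\<And>n. 0 \<le> \<rho> n" "0 \<le> c" "\<forall>\<^sub>F n in sequentially. d n \<le> ennreal (c * \<rho> n)"
  shows "ennreal_bigo d \<rho>"
  unfolding ennreal_bigo_def
proof
  show "\<forall>\<^sub>F n in sequentially. d n < \<top>"
    using assms(3) by eventually_elim (auto intro: le_less_trans)
  show "(\<lambda>n. enn2real (d n)) \<in> O(\<rho>)"
    by (rule bigoI[of _ c], use assms(3) in eventually_elim)
       (use assms in \<open>auto intro: enn2real_leI\<close>)
qed

lemma (in prob_space) nn_integral_const_plus_indicator:
  assumes N: "N \<in> events" and "0 \<le> a" "0 \<le> b"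
  shows "(\<integral>\<^sup>+ x. ennreal a + ennreal b * indicator N x \<partial>M) = ennreal (a + b * prob N)"
  using assms
  by (simp add: nn_integral_add nn_integral_cmult_indicator prob_space emeasure_eq_measure ennreal_mult ennreal_plus)

context wavelet_system begin

text \<open>Hoelder balls in coefficient form, with one bound per level, so that membership can be
  tested coefficient by coefficient.\<close>

definition coef_class :: "(nat \<Rightarrow> real) \<Rightarrow> (real \<Rightarrow> real) set" where
  "coef_class b = {f. cont_density01 f \<and> (\<forall>m. \<forall>k\<in>K m. \<bar>inner01 f (e m k)\<bar> \<le> b m)}"

text \<open>The exact bounds \<open>bs\<close> and \<open>br\<close> define the classes, and
  \<open>bs\<close> the test; their geometric majorants supply the decay from which the rates
  follow.\<close>

theorem adaptive_band:
  assumes rs: "0 < r" "r < s" and \<alpha>: "0 < \<alpha>"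
    and A: "0 \<le> As" "0 \<le> Ar"
    and bs: "\<And>m. bs m \<le> As * (2 powr - (s + 1 / 2)) ^ m"
    and br: "\<And>m. br m \<le> Ar * (2 powr - (r + 1 / 2)) ^ m"
    and bsr: "\<And>m. bs m \<le> br m"
  shows "\<exists>c c' :: nat \<Rightarrow> (nat \<Rightarrow> real) \<Rightarrow> real \<Rightarrow> real.
       (\<forall>n. random_band n (c n) (c' n)) \<and>
       (\<forall>f\<in>coef_class br. liminf (\<lambda>n. ereal (coverage_prob f n (c n) (c' n))) \<ge> ereal (1 - \<alpha>)) \<and>
       (\<forall>f\<in>coef_class bs. ennreal_bigo (\<lambda>n. expected_diameter f n (c n) (c' n)) (rate s)) \<and>
       (\<forall>f\<in>coef_class br. ennreal_bigo (\<lambda>n. expected_diameter f n (c n) (c' n)) (rate r))"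
proof -
  have s: "0 < s" using rs by simp
  have sub: "coef_class bs \<subseteq> coef_class br"
    unfolding coef_class_def using bsr order_trans by fast
  have sqrt2: "1 < sqrt (2::real)" by simp
  have base: "2 powr - r < 1" "2 powr - s < 1" using rs s by (auto simp: powr_less_one)
  have Q: "0 \<le> Q" by (rule Q_nonneg)
  \<comment> \<open>A bound for every density in the larger class, hence independent of
    \<open>f\<close>. The band may depend on the data and the class only, so the constants built
    from \<open>F\<close> must be free of \<open>f\<close>.\<close>
  define F where "F = Ar * D / (1 - 2 powr - r)"
  have F0: "0 \<le> F" using A D_ge_1 base by (simp add: F_def)
  define C where "C = 3 * D + F"
  have C: "0 \<le> C" using D_ge_1 F0 by (simp add: C_def)
  define \<delta> where "\<delta> n = C * sqrt (ln (real n) / real n)" for n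
  \<comment> \<open>\<open>Ls\<close> and \<open>Lr\<close> are the constants of
    \<open>estimator_rate\<close> for \<open>s\<close> and \<open>r\<close>.\<close>
  define Ls where "Ls = As * D / (1 - 2 powr - s) * 2 powr s + C * D / (sqrt 2 - 1)"
  define Lr where "Lr = Ar * D / (1 - 2 powr - r) * 2 powr r + C * D / (sqrt 2 - 1)"
  have L: "0 \<le> Ls" "0 \<le> Lr" using A D_ge_1 base C sqrt2 by (auto simp: Ls_def Lr_def)
  \<comment> \<open>The tolerance \<open>\<delta> n\<close> is the accuracy on the good event, so a
    density of the smoother class passes there for certain.\<close>
  define accept where "accept n X \<longleftrightarrow>
    (\<forall>m\<in>{..<level 0 n}. \<forall>k\<in>K m. \<bar>emp_mean (e m k) n X\<bar> \<le> bs m + \<delta> n)" for n X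
  define centre where "centre n X y =
    (if accept n X then estimator n (level s n) X y else estimator n (level r n) X y)" for n X y
  define width where "width n X = (if accept n X then Ls * rate s n else Lr * rate r n)" for n X
  define c where "c n X y = centre n X y - width n X" for n X y
  define c' where "c' n X y = centre n X y + width n X" for n X y
  define G where "G f n = good_samples f n (level 0 n) (\<delta> n)" for f n
  have width0: "0 \<le> width n X" for n X using L by (simp add: width_def)

  \<comment> \<open>Measurability of the band\<close>
  have accept_meas [measurable]: "Measurable.pred (sample_space n) (accept n)" for n
  proof -
    have "{X \<in> space (sample_space n). \<forall>m\<in>{..<level 0 n}. \<forall>k\<in>K m. \<bar>emp_mean (e m k) n X\<bar> \<le> bs m + \<delta> n}
        \<in> sets (sample_space n)"
      by (intro sets.sets_Collect_finite_All) measurable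
    then show ?thesis unfolding accept_def[abs_def] pred_def .
  qed
  have centre_meas [measurable]: "(\<lambda>X. centre n X y) \<in> borel_measurable (sample_space n)" for n y
    unfolding centre_def by measurable
  have width_meas [measurable]: "width n \<in> borel_measurable (sample_space n)" for n
    unfolding width_def[abs_def] by measurable
  \<comment> \<open>The width does not depend on \<open>y\<close>, which removes the supremum and
    makes the diameter measurable.\<close>
  have diam: "diameter_of_band (c n X) (c' n X) = ennreal (2 * width n X)" for n X
    using width0[of n X] by (simp add: diameter_of_band_def c_def c'_def)
  have band: "random_band n (c n) (c' n)" for n
    unfolding random_band_def diam
  proof (intro conjI ballI)
    fix X y
    show "(\<lambda>X. c n X y) \<in> borel_measurable (sample_space n)" unfolding c_def by measurable
    show "(\<lambda>X. c' n X y) \<in> borel_measurable (sample_space n)" unfolding c'_def by measurable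
    show "(\<lambda>X. ennreal (2 * width n X)) \<in> borel_measurable (sample_space n)" by measurable
    show "c n X y \<le> c' n X y" using width0[of n X] by (simp add: c_def c'_def)
  qed

  \<comment> \<open>Behaviour of the test on the good event\<close>
  have band_iff: "u \<in> {c n X y..c' n X y} \<longleftrightarrow> \<bar>u - centre n X y\<bar> \<le> width n X" for u n X y
    unfolding c_def c'_def atLeastAtMost_iff by linarith
  have dev_meas: "Measurable.pred (sample_space n) (\<lambda>X. \<bar>u - centre n X y\<bar> \<le> width n X)" for u n y
    unfolding pred_def by (intro borel_measurable_le borel_measurable_abs borel_measurable_diff borel_measurable_const
        centre_meas width_meas)
  have coef: "\<bar>inner01 f (e m k)\<bar> \<le> Ar * (2 powr - (r + 1 / 2)) ^ m"
    if "f \<in> coef_class br" "k \<in> K m" for f m k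
    using that br[of m] unfolding coef_class_def by force
  have coef_s: "\<bar>inner01 f (e m k)\<bar> \<le> As * (2 powr - (s + 1 / 2)) ^ m"
    if "f \<in> coef_class bs" "k \<in> K m" for f m k
    using that bs[of m] unfolding coef_class_def by force
  have fc: "continuous_on {0..1} f" "cont_density01 f" if "f \<in> coef_class br" for f
    using that by (auto simp: coef_class_def cont_density01_def)
  \<comment> \<open>With \<open>N = 0\<close> the partial expansion is empty, and the approximation
    error bounds \<open>f\<close> itself.\<close>
  have f_le: "f x \<le> F" if "f \<in> coef_class br" "x \<in> {0..1}" for f x
    using approximation_error[OF fc(1)[OF that(1)] rs(1) A(2) coef[OF that(1)] that(2), of 0]
    by (simp add: partial_expansion_def F_def)
  have prob_G: "measure (joint_law f n) (space (joint_law f n) - G f n) \<le> 2 * Q / (real n)\<^sup>2"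
    if f: "f \<in> coef_class br" and n: "3 \<le> n" for f n
    unfolding G_def \<delta>_def C_def
    using prob_not_good[OF fc(2)[OF f] f_le[OF f] F0 n] level_bounds(1)[OF n, of 0] ratio_ge_1[OF n]
    by simp
  have accept_s: "accept n X" if "f \<in> coef_class bs" "X \<in> G f n" for f n X
    unfolding accept_def
  proof (intro ballI)
    fix m k assume mk: "m \<in> {..<level 0 n}" "k \<in> K m"
    have "\<bar>inner01 f (e m k)\<bar> \<le> bs m" using that mk by (auto simp: coef_class_def)
    moreover have "\<bar>emp_mean (e m k) n X - inner01 f (e m k)\<bar> \<le> \<delta> n"
      using that mk by (auto simp: G_def good_samples_def)
    ultimately show "\<bar>emp_mean (e m k) n X\<bar> \<le> bs m + \<delta> n" by linarith
  qed
  have reject_r: "\<forall>\<^sub>F n in sequentially. \<forall>X\<in>G f n. \<not> accept n X"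
    if f: "f \<in> coef_class br" "f \<notin> coef_class bs" for f
  proof -
    obtain m k where mk: "k \<in> K m" "bs m < \<bar>inner01 f (e m k)\<bar>"
      using f by (auto simp: coef_class_def not_le)
    have "\<delta> \<longlonglongrightarrow> 0"
      unfolding \<delta>_def[abs_def] by real_asymp
    \<comment> \<open>Half the gap suffices: one \<open>\<delta> n\<close> is lost to estimation and
      one to the tolerance of the test.\<close>
    then have "\<forall>\<^sub>F n in sequentially. \<delta> n < (\<bar>inner01 f (e m k)\<bar> - bs m) / 2"
      by (rule order_tendstoD) (use mk in simp)
    moreover have "\<forall>\<^sub>F n in sequentially. m < level 0 n"
      using filterlim_at_top[THEN iffD1, OF level_0_at_top, rule_format, of "Suc m"]
      by (simp add: Suc_le_eq)
    ultimately show ?thesis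
    proof eventually_elim
      case (elim n)
      show ?case
      proof
        fix X assume "X \<in> G f n"
        then have "\<bar>emp_mean (e m k) n X - inner01 f (e m k)\<bar> \<le> \<delta> n"
          using elim(2) mk(1) by (auto simp: G_def good_samples_def)
        then have "\<not> \<bar>emp_mean (e m k) n X\<bar> \<le> bs m + \<delta> n"
          using elim(1) abs_triangle_ineq2_sym[of "inner01 f (e m k)" "emp_mean (e m k) n X"]
          by (simp only: less_divide_eq_numeral1)
        moreover have "m \<in> {..<level 0 n}" using elim(2) by simp
        ultimately show "\<not> accept n X"
          using mk(1) accept_def[THEN iffD1, THEN bspec, THEN bspec, of n X m k] by blast
      qed
    qed
  qed
  \<comment> \<open>Inside the smoother class the test accepts and resolution
    \<open>level s n\<close> is accurate. Outside it the test eventually rejects and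
    \<open>level r n\<close> is used.\<close>
  have covered: "\<forall>\<^sub>F n in sequentially. \<forall>X\<in>G f n. \<forall>y\<in>{0..1}. \<bar>f y - centre n X y\<bar> \<le> width n X"
    if f: "f \<in> coef_class br" for f
  proof (cases "f \<in> coef_class bs")
    case True
    show ?thesis using eventually_ge_at_top[of 3]
    proof eventually_elim
      case (elim n)
      show ?case
      proof (intro ballI)
        fix X y assume X: "X \<in> G f n" and y: "y \<in> {0..1::real}"
        have "\<bar>f y - estimator n (level s n) X y\<bar> \<le> Ls * rate s n"
          unfolding Ls_def
          by (rule estimator_rate[OF fc(1)[OF f] s A(1) coef_s[OF True] elim C y X[unfolded G_def \<delta>_def]])
        then show "\<bar>f y - centre n X y\<bar> \<le> width n X"
          by (simp only: centre_def width_def accept_s[OF True X] if_True)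
      qed
    qed
  next
    case False
    show ?thesis using eventually_ge_at_top[of 3] reject_r[OF f False]
    proof eventually_elim
      case (elim n)
      show ?case
      proof (intro ballI)
        fix X y assume X: "X \<in> G f n" and y: "y \<in> {0..1::real}"
        have "\<bar>f y - estimator n (level r n) X y\<bar> \<le> Lr * rate r n"
          unfolding Lr_def
          by (rule estimator_rate[OF fc(1)[OF f] rs(1) A(2) coef[OF f] elim(1) C y X[unfolded G_def \<delta>_def]])
        then show "\<bar>f y - centre n X y\<bar> \<le> width n X"
          using elim(2) X by (simp only: centre_def width_def if_False)
      qed
    qed
  qed

  \<comment> \<open>Asymptotic coverage\<close>
  have coverage: "liminf (\<lambda>n. ereal (coverage_prob f n (c n) (c' n))) \<ge> ereal (1 - \<alpha>)"
    if f: "f \<in> coef_class br" for f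
  proof (rule Liminf_bounded)
    have "(\<lambda>n. 2 * Q / (real n)\<^sup>2) \<longlonglongrightarrow> 0" by real_asymp
    then have "\<forall>\<^sub>F n in sequentially. 2 * Q / (real n)\<^sup>2 < \<alpha>"
      using \<alpha> by (rule order_tendstoD)
    with covered[OF f] eventually_ge_at_top[of 3]
    show "\<forall>\<^sub>F n in sequentially. ereal (1 - \<alpha>) \<le> ereal (coverage_prob f n (c n) (c' n))"
    proof eventually_elim
      case (elim n)
      interpret P: prob_space "joint_law f n" by (rule prob_space_joint_law[OF fc(2)[OF f]])
      let ?E = "{X \<in> space (joint_law f n). \<forall>y\<in>{0..1}. f y \<in> {c n X y..c' n X y}}"
      have E_eq: "?E = {X \<in> space (sample_space n).
          \<forall>q\<in>{0<..<1::rat}. \<bar>f (of_rat q) - centre n X (of_rat q)\<bar> \<le> width n X}"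
      proof -
        have "continuous_on {0..1} (centre n X)" for X
          by (cases "accept n X") (simp_all add: centre_def[abs_def] continuous_estimator)
        then have "(\<forall>y\<in>{0..1}. \<bar>f y - centre n X y\<bar> \<le> width n X) \<longleftrightarrow>
            (\<forall>q\<in>{0<..<1::rat}. \<bar>f (of_rat q) - centre n X (of_rat q)\<bar> \<le> width n X)" for X
          by (intro continuous_all_le_iff_rat[where h = "\<lambda>y. \<bar>f y - centre n X y\<bar>"]
              continuous_intros fc(1)[OF f])
        then show ?thesis by (simp only: band_iff space_joint_law)
      qed
      have E: "?E \<in> sets (joint_law f n)"
        unfolding E_eq sets_joint_law
        by (rule pred_intros_countable_bounded(3)[OF dev_meas, unfolded pred_def])
      have G: "G f n \<in> sets (joint_law f n)" unfolding G_def sets_joint_law by (rule good_samples_sets)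
      have "1 - \<alpha> \<le> measure (joint_law f n) (G f n)"
        using prob_G[OF f elim(2)] elim(3) P.prob_compl[OF G] by linarith
      also have "\<dots> \<le> measure (joint_law f n) ?E"
      proof (rule P.finite_measure_mono[OF _ E])
        show "G f n \<subseteq> ?E"
        proof
          fix X assume X: "X \<in> G f n"
          then have "X \<in> space (joint_law f n)" by (simp add: G_def good_samples_def space_joint_law)
          moreover have "\<forall>y\<in>{0..1}. \<bar>f y - centre n X y\<bar> \<le> width n X" using elim(1) X by blast
          ultimately show "X \<in> ?E" unfolding band_iff by blast
        qed
      qed
      finally show ?case by (simp add: coverage_prob_def)
    qed
  qed

  \<comment> \<open>Expected diameter\<close>
  have diam_r: "ennreal_bigo (\<lambda>n. expected_diameter f n (c n) (c' n)) (rate r)"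
    if f: "f \<in> coef_class br" for f
  proof (rule ennreal_bigoI[of _ "2 * (Ls + Lr)"])
    show "\<forall>\<^sub>F n in sequentially. expected_diameter f n (c n) (c' n) \<le> ennreal (2 * (Ls + Lr) * rate r n)"
      using eventually_ge_at_top[of 3]
    proof eventually_elim
      case (elim n)
      interpret P: prob_space "joint_law f n" by (rule prob_space_joint_law[OF fc(2)[OF f]])
      have "Ls * rate s n \<le> Ls * rate r n"
        using L rs by (intro mult_left_mono rate_antimono elim) auto
      moreover have "0 \<le> Ls * rate r n" "0 \<le> Lr * rate r n" using L by simp_all
      ultimately have "width n X \<le> (Ls + Lr) * rate r n" for X
        unfolding width_def distrib_right
        by (cases "accept n X"; simp only: if_True if_False; linarith)
      then have w: "2 * width n X \<le> 2 * (Ls + Lr) * rate r n" for X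
        unfolding mult.assoc by (intro mult_left_mono) auto
      have "expected_diameter f n (c n) (c' n) \<le> (\<integral>\<^sup>+ X. ennreal (2 * (Ls + Lr) * rate r n) \<partial>joint_law f n)"
        unfolding expected_diameter_def diam by (intro nn_integral_mono ennreal_leI) (rule w)
      then show ?case by (simp add: P.emeasure_space_1)
    qed
  qed (use L in auto)

  have diam_s: "ennreal_bigo (\<lambda>n. expected_diameter f n (c n) (c' n)) (rate s)"
    if fs: "f \<in> coef_class bs" for f
  \<comment> \<open>The second summand is the crude diameter bound \<open>2 * Lr\<close> times the
    constant \<open>2 * Q\<close> from the probability of the exceptional event.\<close>
  proof (rule ennreal_bigoI[of _ "2 * Ls + 4 * Lr * Q"])
    have f: "f \<in> coef_class br" using fs sub by auto
    show "\<forall>\<^sub>F n in sequentially. expected_diameter f n (c n) (c' n) \<le> ennreal ((2 * Ls + 4 * Lr * Q) * rate s n)"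
      using eventually_ge_at_top[of 3]
    proof eventually_elim
      case (elim n)
      interpret P: prob_space "joint_law f n" by (rule prob_space_joint_law[OF fc(2)[OF f]])
      let ?N = "space (joint_law f n) - G f n"
      have N: "?N \<in> sets (joint_law f n)" unfolding G_def
        using good_samples_sets sets_joint_law by blast
      \<comment> \<open>Rejection occurs only off the good event, where
        \<open>rate r n \<le> 1\<close> bounds the width by \<open>Lr\<close>.\<close>
      have w: "ennreal (2 * width n X) \<le> ennreal (2 * Ls * rate s n) + ennreal (2 * Lr) * indicator ?N X"
        if X: "X \<in> space (joint_law f n)" for X
      proof (cases "accept n X")
        case True
        then have "ennreal (2 * width n X) = ennreal (2 * Ls * rate s n)"
          by (simp add: width_def mult.assoc)
        also have "\<dots> \<le> \<dots> + ennreal (2 * Lr) * indicator ?N X"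
          by (rule add_increasing2) simp_all
        finally show ?thesis .
      next
        case False
        then have "X \<in> ?N" using accept_s[OF fs] X by blast
        have "Lr * rate r n \<le> Lr"
          using L rs rate_le_1[OF elim, of r] by (simp add: mult_left_le)
        then have "ennreal (2 * width n X) \<le> ennreal (2 * Lr) * indicator ?N X"
          using False \<open>X \<in> ?N\<close> by (simp add: width_def ennreal_leI)
        also have "\<dots> \<le> ennreal (2 * Ls * rate s n) + \<dots>"
          by (rule add_increasing) simp_all
        finally show ?thesis .
      qed
      have "expected_diameter f n (c n) (c' n) \<le>
          (\<integral>\<^sup>+ X. ennreal (2 * Ls * rate s n) + ennreal (2 * Lr) * indicator ?N X \<partial>joint_law f n)"
        unfolding expected_diameter_def diam by (intro nn_integral_mono w)
      also have "\<dots> = ennreal (2 * Ls * rate s n + 2 * Lr * measure (joint_law f n) ?N)"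
        by (rule P.nn_integral_const_plus_indicator[OF N]) (use L in simp_all)
      also have "\<dots> \<le> ennreal ((2 * Ls + 4 * Lr * Q) * rate s n)"
      proof (rule ennreal_leI)
        have "measure (joint_law f n) ?N \<le> 2 * Q / (real n)\<^sup>2" by (rule prob_G[OF f elim])
        also have "\<dots> \<le> 2 * Q * (1 / real n)"
          using mult_left_mono[of 1 "real n" Q] Q elim by (simp add: divide_simps power2_eq_square)
        also have "\<dots> \<le> 2 * Q * rate s n"
          using Q s by (intro mult_left_mono rate_ge elim) auto
        finally have "2 * Lr * measure (joint_law f n) ?N \<le> 2 * Lr * (2 * Q * rate s n)"
          using L by (intro mult_left_mono) auto
        then show "2 * Ls * rate s n + 2 * Lr * measure (joint_law f n) ?N \<le> (2 * Ls + 4 * Lr * Q) * rate s n"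
          by (simp add: algebra_simps)
      qed
      finally show ?case .
    qed
  qed (use L Q in auto)

  show ?thesis
    using band coverage diam_r diam_s by (intro exI[of _ c] exI[of _ c'] conjI) blast+
qed

end

section \<open>Daubechies bases of the unit interval\<close>

text \<open>Membership in \<open>bcontfun\<close> carries continuity and boundedness together
  through the finite combinations that define wavelets and edge functions.\<close>

lemma bcontfun_sum:
  "finite I \<Longrightarrow> (\<And>i. i \<in> I \<Longrightarrow> g i \<in> bcontfun) \<Longrightarrow> (\<lambda>x. \<Sum>i\<in>I. g i x :: real) \<in> bcontfun"
  by (induction I rule: finite_induct) (auto intro!: plus_cont const_bcontfun)

lemma bcontfun_cmult: "g \<in> bcontfun \<Longrightarrow> (\<lambda>x. c * g x :: real) \<in> bcontfun"
  using scaleR_cont[of g c] by simp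

lemma bcontfun_compose:
  "g \<in> bcontfun \<Longrightarrow> continuous_on UNIV u \<Longrightarrow> (\<lambda>x. g (u x)) \<in> bcontfun"
  unfolding bcontfun_def
  by (auto intro: continuous_on_compose2 bounded_subset)

lemma bcontfun_finite_bound:
  fixes g :: "nat \<Rightarrow> real \<Rightarrow> real"
  assumes "\<And>i. i < M \<Longrightarrow> g i \<in> bcontfun"
  shows "\<exists>H\<ge>0. \<forall>i<M. \<forall>x. \<bar>g i x\<bar> \<le> H"
proof -
  have "\<forall>i\<in>{..<M}. \<exists>b. \<forall>x. \<bar>g i x\<bar> \<le> b"
    using assms by (auto simp: bcontfun_def bounded_iff)
  then obtain b where b: "\<And>i x. i < M \<Longrightarrow> \<bar>g i x\<bar> \<le> b i" by (auto simp: bchoice_iff)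
  have "\<bar>g i x\<bar> \<le> (\<Sum>j<M. \<bar>b j\<bar>)" if "i < M" for i x
    using b[OF that, of x] member_le_sum[of i "{..<M}" "\<lambda>j. \<bar>b j\<bar>"] that by auto
  then show ?thesis by (intro exI[of _ "\<Sum>j<M. \<bar>b j\<bar>"]) (auto intro: sum_nonneg)
qed

lemma bcontfun_compact_support:
  fixes g :: "real \<Rightarrow> real"
  assumes "continuous_on UNIV g" "\<And>x. x \<notin> {a..b} \<Longrightarrow> g x = 0"
  shows "g \<in> bcontfun"
proof -
  have "bounded (g ` {a..b})"
    using assms by (intro compact_imp_bounded compact_continuous_image) (auto intro: continuous_on_subset)
  then have "bounded (insert 0 (g ` {a..b}))" by simp
  moreover have "range g \<subseteq> insert 0 (g ` {a..b})"
  proof (rule image_subsetI)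
    fix x show "g x \<in> insert 0 (g ` {a..b})" using assms(2)[of x] by blast
  qed
  ultimately have "bounded (range g)" by (rule bounded_subset)
  then show ?thesis using assms(1) by (simp add: bcontfun_def)
qed

lemma powr_half_level: "2 powr (real l / 2) = sqrt 2 ^ l"
  by (simp add: powr_half_sqrt[symmetric] powr_realpow[symmetric] powr_powr)

text \<open>Localisation: at a given point at most 2M edge functions and 2M + 1 interior translates
  can be nonzero, each of size at most H 2^(l/2).\<close>

lemma sum_abs_interval_family_le:
  assumes gL: "\<And>i y. i < M \<Longrightarrow> \<bar>gL i y\<bar> \<le> H" and gR: "\<And>i y. i < M \<Longrightarrow> \<bar>gR i y\<bar> \<le> H"
    and g: "\<And>y. \<bar>g y\<bar> \<le> H" "\<And>y. y \<notin> {- real M + 1..real M} \<Longrightarrow> g y = 0"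
  shows "(\<Sum>k\<in>{1..2 ^ l}. \<bar>interval_family M gL g gR l k x\<bar>) \<le> real (4 * M + 1) * H * sqrt 2 ^ l"
proof -
  let ?f = "\<lambda>k. \<bar>interval_family M gL g gR l k x\<bar>"
  \<comment> \<open>A translate is nonzero at \<open>x\<close> only if k lies between 2^l x + 1 - M
    and 2^l x + M. The window of 2M + 1 integers from \<open>a\<close> on also covers the rounding
    down.\<close>
  define a where "a = nat \<lfloor>2 ^ l * x + 1 - real M\<rfloor>"
  define T where "T = {1..M} \<union> {2 ^ l - M<..2 ^ l} \<union> {a..a + 2 * M}"
  have H: "0 \<le> H" using g(1)[of 0] by linarith
  have zero: "?f k = 0" if k: "k \<in> {1..2 ^ l}" "k \<notin> T" for k
  proof -
    have "M < k" "k \<le> 2 ^ l - M" "k \<notin> {a..a + 2 * M}" using k by (auto simp: T_def)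
    moreover have "2 ^ l * x - real (k - 1) \<notin> {- real M + 1..real M}"
    proof
      assume "2 ^ l * x - real (k - 1) \<in> {- real M + 1..real M}"
      then have "2 ^ l * x + 1 - real M \<le> real k" "real k \<le> 2 ^ l * x + 1 - real M + 2 * real M - 1"
        using k by (auto simp: of_nat_diff)
      then have "k \<in> {a..a + 2 * M}" unfolding a_def atLeastAtMost_iff by linarith
      then show False using \<open>k \<notin> {a..a + 2 * M}\<close> by simp
    qed
    ultimately show ?thesis using g(2) by (simp add: interval_family_def)
  qed
  have bound: "?f k \<le> H * sqrt 2 ^ l" if k: "k \<in> {1..2 ^ l}" for k
  proof -
    have "2 ^ l - k < M" if "\<not> k \<le> 2 ^ l - M" "\<not> k \<le> M" using that k by auto
    then have "\<bar>if k \<le> M then gL (k - 1) (2 ^ l * x)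
        else if k \<le> 2 ^ l - M then g (2 ^ l * x - real (k - 1))
        else gR (2 ^ l - k) (2 ^ l * (x - 1))\<bar> \<le> H"
      using k by (auto intro!: gL gR g)
    then show ?thesis
      unfolding interval_family_def powr_half_level abs_mult
      by (subst mult.commute) (intro mult_mono, auto simp: H)
  qed
  have "card T \<le> card ({1..M} \<union> {2 ^ l - M<..2 ^ l}) + card {a..a + 2 * M}"
    unfolding T_def by (rule card_Un_le)
  also have "card ({1..M} \<union> {2 ^ l - M<..2 ^ l}) \<le> card {1..M} + card {2 ^ l - M<..(2::nat) ^ l}"
    by (rule card_Un_le)
  finally have card_T: "card T \<le> 4 * M + 1" by simp
  have fin: "finite T" by (simp add: T_def)
  have "(\<Sum>k\<in>{1..2 ^ l}. ?f k) = (\<Sum>k\<in>{1..2 ^ l} \<inter> T. ?f k)"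
    using zero by (intro sum.mono_neutral_right) auto
  also have "\<dots> \<le> real (card ({1..2 ^ l} \<inter> T)) * (H * sqrt 2 ^ l)"
    by (rule sum_bounded_above) (use bound in auto)
  also have "\<dots> \<le> real (4 * M + 1) * (H * sqrt 2 ^ l)"
  proof (rule mult_right_mono)
    have "card ({1..2 ^ l} \<inter> T) \<le> card T" using fin by (intro card_mono) auto
    then show "real (card ({1..2 ^ l} \<inter> T)) \<le> real (4 * M + 1)" using card_T by linarith
  qed (use H in simp)
  finally show ?thesis by (simp add: mult.assoc)
qed

lemma continuous_interval_family:
  assumes gL: "\<And>i. i < M \<Longrightarrow> continuous_on UNIV (gL i)" and gR: "\<And>i. i < M \<Longrightarrow> continuous_on UNIV (gR i)"
    and g: "continuous_on UNIV g" and k: "k \<in> {1..2 ^ l}"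
  shows "continuous_on A (interval_family M gL g gR l k)"
proof -
  consider "k \<le> M" | "\<not> k \<le> M" "k \<le> 2 ^ l - M" | "\<not> k \<le> M" "\<not> k \<le> 2 ^ l - M" by blast
  then show ?thesis
  proof cases
    case 1
    then have "continuous_on UNIV (gL (k - 1))" using k by (intro gL) auto
    then have "continuous_on A (\<lambda>x. gL (k - 1) (2 ^ l * x))"
      by (rule continuous_on_compose2[OF _ _ subset_UNIV]) (intro continuous_intros)
    then show ?thesis unfolding interval_family_def[abs_def] using 1 by (simp add: continuous_on_mult_left)
  next
    case 2
    have "continuous_on A (\<lambda>x. g (2 ^ l * x - real (k - 1)))"
      by (rule continuous_on_compose2[OF g _ subset_UNIV]) (intro continuous_intros)
    then show ?thesis unfolding interval_family_def[abs_def] using 2 by (simp add: continuous_on_mult_left)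
  next
    case 3
    then have "continuous_on UNIV (gR (2 ^ l - k))" using k by (intro gR) auto
    then have "continuous_on A (\<lambda>x. gR (2 ^ l - k) (2 ^ l * (x - 1)))"
      by (rule continuous_on_compose2[OF _ _ subset_UNIV]) (intro continuous_intros)
    then show ?thesis unfolding interval_family_def[abs_def] using 3 by (simp add: continuous_on_mult_left)
  qed
qed

text \<open>Merges scaling functions and wavelets into one sequence of levels starting at 0. The
  shift by \<open>J0\<close> goes into the constants of \<open>wavelet_system\<close>.\<close>

definition graded_basis ::
  "nat \<Rightarrow> (nat \<Rightarrow> real \<Rightarrow> real) \<Rightarrow> (nat \<Rightarrow> nat \<Rightarrow> real \<Rightarrow> real) \<Rightarrow> nat \<Rightarrow> nat \<Rightarrow> real \<Rightarrow> real" where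
  "graded_basis J0 scl wav m = (case m of 0 \<Rightarrow> scl | Suc j \<Rightarrow> wav (J0 + j))"

definition graded_index :: "nat \<Rightarrow> nat \<Rightarrow> nat set" where
  "graded_index J0 m = (case m of 0 \<Rightarrow> {1..2 ^ J0} | Suc j \<Rightarrow> {1..2 ^ (J0 + j)})"

lemma graded_simps [simp]:
  "graded_basis J0 scl wav 0 = scl" "graded_basis J0 scl wav (Suc j) = wav (J0 + j)"
  "graded_index J0 0 = {1..2 ^ J0}" "graded_index J0 (Suc j) = {1..2 ^ (J0 + j)}"
  by (simp_all add: graded_basis_def graded_index_def)

lemma partial_expansion_graded:
  "partial_expansion (graded_basis J0 scl wav) (graded_index J0) f (Suc n) x =
     (\<Sum>k\<in>{1..2 ^ J0}. inner01 f (scl k) * scl k x) +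
     (\<Sum>l\<in>{J0..<n + J0}. \<Sum>k\<in>{1..2 ^ l}. inner01 f (wav l k) * wav l k x)"
  unfolding partial_expansion_def sum.lessThan_Suc_shift graded_simps
  by (subst sum.atLeastLessThan_shift_0) (simp add: lessThan_atLeast0)

text \<open>Completeness of the basis, reindexed: truncation at \<open>Suc n\<close> merged levels
  is truncation of the wavelets before resolution \<open>n + J0\<close>.\<close>

lemma graded_basis_complete:
  assumes basis: "orthonormal_basis01 J0 scl wav" and f: "continuous_on {0..1} f"
  shows "(\<lambda>N. LINT x:{0..1}|lborel.
    (f x - partial_expansion (graded_basis J0 scl wav) (graded_index J0) f N x)\<^sup>2) \<longlonglongrightarrow> 0"
proof -
  have "set_borel_measurable lborel {0..1} f"
    using borel_integrable_atLeastAtMost'[OF f]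
    unfolding set_integrable_def set_borel_measurable_def by (rule borel_measurable_integrable)
  moreover have "set_integrable lborel {0..1} (\<lambda>x. (f x)\<^sup>2)"
    by (intro borel_integrable_atLeastAtMost' continuous_intros f)
  ultimately have "(\<lambda>J. LINT x:{0..1}|lborel.
       (f x - (\<Sum>k\<in>{1..2 ^ J0}. inner01 f (scl k) * scl k x)
            - (\<Sum>l\<in>{J0..<J}. \<Sum>k\<in>{1..2 ^ l}. inner01 f (wav l k) * wav l k x))\<^sup>2) \<longlonglongrightarrow> 0"
    using basis unfolding orthonormal_basis01_def by blast
  from LIMSEQ_ignore_initial_segment[OF this, of J0]
  have "(\<lambda>n. LINT x:{0..1}|lborel.
    (f x - partial_expansion (graded_basis J0 scl wav) (graded_index J0) f (Suc n) x)\<^sup>2) \<longlonglongrightarrow> 0"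
    unfolding partial_expansion_graded by (simp only: diff_diff_eq)
  then show ?thesis by (rule LIMSEQ_imp_Suc)
qed

text \<open>Smoothness makes \<phi> continuous and compact support makes it bounded. The other
  functions are finite combinations of its translates and dilates, so one bound \<open>H\<close>
  serves all six families.\<close>

lemma wavelet_system_interval_basis:
  assumes basis: "daubechies_interval_basis S J0 scl wav" and S: "0 < S"
  shows "\<exists>D. wavelet_system (graded_basis J0 scl wav) (graded_index J0) D (2 ^ J0)"
proof -
  obtain M h \<phi> \<psi> \<phi>L \<phi>R \<psi>L \<psi>R where
    pair: "daubechies_pair M h \<phi> \<psi>" and smooth: "times_cont_diff S \<phi>"
    and scaling: "edge_scaling M \<phi> \<phi>L \<phi>R" and wavelets: "edge_wavelets M \<phi> \<phi>L \<phi>R \<psi>L \<psi>R"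
    and scl: "\<And>k x. k \<in> {1..2 ^ J0} \<Longrightarrow> x \<in> {0..1} \<Longrightarrow> scl k x = interval_family M \<phi>L \<phi> \<phi>R J0 k x"
    and wav: "\<And>l k x. J0 \<le> l \<Longrightarrow> k \<in> {1..2 ^ l} \<Longrightarrow> x \<in> {0..1} \<Longrightarrow>
      wav l k x = interval_family M \<psi>L \<psi> \<psi>R l k x"
    and orth: "orthonormal_basis01 J0 scl wav"
    using basis unfolding daubechies_interval_basis_def by blast
  have "\<phi> differentiable_on UNIV"
    using smooth S unfolding times_cont_diff_def by (metis funpow_0)
  moreover have \<phi>0: "\<And>x. x \<notin> {- real M + 1..real M} \<Longrightarrow> \<phi> x = 0"
    using pair unfolding daubechies_pair_def by blast
  ultimately have \<phi>: "\<phi> \<in> bcontfun"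
    by (intro bcontfun_compact_support differentiable_imp_continuous_on)
  have \<psi>_eq: "\<psi> = (\<lambda>x. sqrt 2 *
      (\<Sum>k\<in>{- int M + 1..int M}. (-1) powi k * h (1 - k) * \<phi> (2 * x - of_int k)))"
    by (rule ext) (use pair in \<open>unfold daubechies_pair_def, blast\<close>)
  have \<psi>: "\<psi> \<in> bcontfun" unfolding \<psi>_eq
    by (intro bcontfun_sum bcontfun_cmult bcontfun_compose[OF \<phi>] continuous_intros) simp
  \<comment> \<open>If x lies outside the support interval and k inside it, then 2x - k lies outside
    on the same side as x.\<close>
  have \<psi>0: "\<psi> x = 0" if x: "x \<notin> {- real M + 1..real M}" for x
  proof -
    have "\<phi> (2 * x - of_int k) = 0" if k: "k \<in> {- int M + 1..int M}" for k
    proof (rule \<phi>0)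
      have "- real M + 1 \<le> of_int k" "of_int k \<le> real M" using k by auto
      then show "2 * x - of_int k \<notin> {- real M + 1..real M}" using x by auto
    qed
    then show ?thesis by (simp add: \<psi>_eq)
  qed
  have L: "left_edge_sum M \<phi> q \<in> bcontfun" "right_edge_sum M \<phi> q \<in> bcontfun" for q
    unfolding left_edge_sum_def[abs_def] right_edge_sum_def[abs_def]
    by (intro bcontfun_sum bcontfun_cmult bcontfun_compose[OF \<phi>] continuous_intros; simp)+
  have \<phi>LR: "\<phi>L i \<in> bcontfun" "\<phi>R i \<in> bcontfun" if i: "i < M" for i
  proof -
    obtain a b where "\<phi>L i = (\<lambda>x. \<Sum>q<M. a i q * left_edge_sum M \<phi> q x)"
        "\<phi>R i = (\<lambda>x. \<Sum>q<M. b i q * right_edge_sum M \<phi> q x)"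
      using scaling i unfolding edge_scaling_def by blast
    then show "\<phi>L i \<in> bcontfun" "\<phi>R i \<in> bcontfun"
      by (auto intro!: bcontfun_sum bcontfun_cmult L)
  qed
  have \<psi>LR: "\<psi>L i \<in> bcontfun" "\<psi>R i \<in> bcontfun" if i: "i < M" for i
  proof -
    obtain a b c d where "\<psi>L i = (\<lambda>x. (\<Sum>q<M. a i q * \<phi>L q (2 * x)) +
                 (\<Sum>m\<in>{M..3 * M - 2}. b i m * \<phi> (2 * x - real m)))"
        "\<psi>R i = (\<lambda>x. (\<Sum>q<M. c i q * \<phi>R q (2 * x)) +
                 (\<Sum>m\<in>{M..3 * M - 2}. d i m * \<phi> (2 * x + real m + 1)))"
      using wavelets i unfolding edge_wavelets_def by blast
    then show "\<psi>L i \<in> bcontfun" "\<psi>R i \<in> bcontfun"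
      by (simp_all only:)
        (intro plus_cont bcontfun_sum bcontfun_cmult bcontfun_compose[OF \<phi>]
          bcontfun_compose[OF \<phi>LR(1)] bcontfun_compose[OF \<phi>LR(2)] continuous_intros; simp)+
  qed
  obtain H1 where H1: "0 \<le> H1" "\<forall>i<M. \<forall>x. \<bar>\<phi>L i x\<bar> \<le> H1"
    using bcontfun_finite_bound[of M "\<phi>L"] \<phi>LR(1) by blast
  obtain H2 where H2: "0 \<le> H2" "\<forall>i<M. \<forall>x. \<bar>\<phi>R i x\<bar> \<le> H2"
    using bcontfun_finite_bound[of M "\<phi>R"] \<phi>LR(2) by blast
  obtain H3 where H3: "0 \<le> H3" "\<forall>i<M. \<forall>x. \<bar>\<psi>L i x\<bar> \<le> H3"
    using bcontfun_finite_bound[of M "\<psi>L"] \<psi>LR(1) by blast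
  obtain H4 where H4: "0 \<le> H4" "\<forall>i<M. \<forall>x. \<bar>\<psi>R i x\<bar> \<le> H4"
    using bcontfun_finite_bound[of M "\<psi>R"] \<psi>LR(2) by blast
  obtain H5 where H5: "0 \<le> H5" "\<forall>i<(1::nat). \<forall>x. \<bar>\<phi> x\<bar> \<le> H5"
    using bcontfun_finite_bound[of 1 "\<lambda>_. \<phi>", OF \<phi>] by blast
  obtain H6 where H6: "0 \<le> H6" "\<forall>i<(1::nat). \<forall>x. \<bar>\<psi> x\<bar> \<le> H6"
    using bcontfun_finite_bound[of 1 "\<lambda>_. \<psi>", OF \<psi>] by blast
  define H where "H = H1 + H2 + H3 + H4 + H5 + H6"
  have H: "i < M \<Longrightarrow> \<bar>\<phi>L i x\<bar> \<le> H" "i < M \<Longrightarrow> \<bar>\<phi>R i x\<bar> \<le> H"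
    "i < M \<Longrightarrow> \<bar>\<psi>L i x\<bar> \<le> H" "i < M \<Longrightarrow> \<bar>\<psi>R i x\<bar> \<le> H" "\<bar>\<phi> x\<bar> \<le> H" "\<bar>\<psi> x\<bar> \<le> H" "0 \<le> H" for i x
    using H1(2)[rule_format, of i x] H2(2)[rule_format, of i x] H3(2)[rule_format, of i x] H4(2)[rule_format, of i x] H5(2)[rule_format, of 0 x] H6(2)[rule_format, of 0 x]
      H1(1) H2(1) H3(1) H4(1) H5(1) H6(1) by (simp_all add: H_def)
  \<comment> \<open>\<open>sqrt 2 ^ J0\<close> absorbs the shift of levels, and the added 1 secures
    \<open>1 \<le> D\<close>.\<close>
  define D where "D = real (4 * M + 1) * H * sqrt 2 ^ J0 + 1"
  have D: "0 \<le> real (4 * M + 1) * H * sqrt 2 ^ J0" using H(7) by simp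
  have cont: "continuous_on UNIV \<phi>" "continuous_on UNIV \<psi>"
    "\<And>i. i < M \<Longrightarrow> continuous_on UNIV (\<phi>L i)" "\<And>i. i < M \<Longrightarrow> continuous_on UNIV (\<phi>R i)"
    "\<And>i. i < M \<Longrightarrow> continuous_on UNIV (\<psi>L i)" "\<And>i. i < M \<Longrightarrow> continuous_on UNIV (\<psi>R i)"
    using \<phi> \<psi> \<phi>LR \<psi>LR by (auto simp: bcontfun_def)
  let ?e = "graded_basis J0 scl wav" and ?K = "graded_index J0"
  have "wavelet_system ?e ?K D (2 ^ J0)"
  proof
    fix m k assume k: "k \<in> ?K m"
    show "continuous_on {0..1} (?e m k)"
    proof (cases m)
      case 0
      have "continuous_on {0..1} (interval_family M \<phi>L \<phi> \<phi>R J0 k)"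
        by (rule continuous_interval_family) (use cont k 0 in simp_all)
      then have "continuous_on {0..1} (scl k)"
        by (rule continuous_on_eq) (use scl k 0 in simp)
      then show ?thesis using 0 by simp
    next
      case (Suc j)
      have "continuous_on {0..1} (interval_family M \<psi>L \<psi> \<psi>R (J0 + j) k)"
        by (rule continuous_interval_family) (use cont k Suc in simp_all)
      then have "continuous_on {0..1} (wav (J0 + j) k)"
        by (rule continuous_on_eq) (use wav k Suc in simp)
      then show ?thesis using Suc by simp
    qed
    show "inner01 (?e m k) (?e m k) = 1"
      using orth k by (cases m) (auto simp: orthonormal_basis01_def)
  next
    fix m show "finite (?K m)" by (cases m) auto
    show "real (card (?K m)) \<le> 2 ^ J0 * 2 ^ m" by (cases m) (auto simp: power_add)
  next
    fix x :: real and m assume x: "x \<in> {0..1}"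
    have "(\<Sum>k\<in>?K m. \<bar>?e m k x\<bar>) \<le> real (4 * M + 1) * H * sqrt 2 ^ J0 * sqrt 2 ^ m"
    proof (cases m)
      case 0
      have "(\<Sum>k\<in>{1..2 ^ J0}. \<bar>scl k x\<bar>) = (\<Sum>k\<in>{1..2 ^ J0}. \<bar>interval_family M \<phi>L \<phi> \<phi>R J0 k x\<bar>)"
        using scl x by (intro sum.cong) auto
      also have "\<dots> \<le> real (4 * M + 1) * H * sqrt 2 ^ J0"
        by (rule sum_abs_interval_family_le) (use H \<phi>0 in auto)
      finally show ?thesis using 0 by simp
    next
      case (Suc j)
      have "(\<Sum>k\<in>{1..2 ^ (J0 + j)}. \<bar>wav (J0 + j) k x\<bar>) =
          (\<Sum>k\<in>{1..2 ^ (J0 + j)}. \<bar>interval_family M \<psi>L \<psi> \<psi>R (J0 + j) k x\<bar>)"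
        using wav[of "J0 + j"] x by (intro sum.cong) auto
      also have "\<dots> \<le> real (4 * M + 1) * H * sqrt 2 ^ (J0 + j)"
        by (rule sum_abs_interval_family_le) (use H \<psi>0 in auto)
      also have "\<dots> \<le> real (4 * M + 1) * H * sqrt 2 ^ J0 * sqrt 2 ^ m"
        unfolding power_add mult.assoc[symmetric] using D
        by (intro mult_left_mono) (auto simp: Suc)
      finally show ?thesis using Suc by simp
    qed
    also have "\<dots> \<le> D * sqrt 2 ^ m" by (intro mult_right_mono) (auto simp: D_def)
    finally show "(\<Sum>k\<in>?K m. \<bar>?e m k x\<bar>) \<le> D * sqrt 2 ^ m" .
  next
    show "1 \<le> D" using D by (simp add: D_def)
  next
    fix f :: "real \<Rightarrow> real" assume "continuous_on {0..1} f"
    then show "(\<lambda>N. LINT x:{0..1}|lborel. (f x - partial_expansion ?e ?K f N x)\<^sup>2) \<longlonglongrightarrow> 0"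
      by (rule graded_basis_complete[OF orth])
  qed
  then show ?thesis ..
qed

section \<open>Hoelder balls as coefficient classes\<close>

definition coef_bound :: "nat \<Rightarrow> real \<Rightarrow> real \<Rightarrow> nat \<Rightarrow> real" where
  "coef_bound J0 B t m = (case m of 0 \<Rightarrow> B | Suc j \<Rightarrow> B / 2 powr (real (J0 + j) * (t + 1 / 2)))"

text \<open>A supremum is at most \<open>B\<close> exactly when all its members are; the weight of
  each level then moves to the right-hand side.\<close>

lemma hoelder_norm_le_iff:
  "hoelder_norm J0 scl wav t f \<le> ereal B \<longleftrightarrow>
     (\<forall>m. \<forall>k\<in>graded_index J0 m. \<bar>inner01 f (graded_basis J0 scl wav m k)\<bar> \<le> coef_bound J0 B t m)"
    (is "_ \<longleftrightarrow> (\<forall>m. ?P m)")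
proof -
  have "(\<forall>l\<ge>J0. R l) \<longleftrightarrow> (\<forall>j. R (J0 + j))" for R :: "nat \<Rightarrow> bool"
    by (metis le_add1 le_Suc_ex)
  then have "hoelder_norm J0 scl wav t f \<le> ereal B \<longleftrightarrow> ?P 0 \<and> (\<forall>j. ?P (Suc j))"
    unfolding hoelder_norm_def
    by (simp add: SUP_le_iff Ball_def[of "{J0..}"] coef_bound_def pos_le_divide_eq mult.commute)
  also have "\<dots> \<longleftrightarrow> (\<forall>m. ?P m)" by (metis not0_implies_Suc)
  finally show ?thesis .
qed

text \<open>Merged level \<open>m\<close> carries wavelets of resolution at least m - 1; the factor
  2^(t + 1/2) compensates for this shift by one.\<close>

lemma coef_bound_geometric:
  assumes "0 \<le> B" "0 \<le> t"
  shows "coef_bound J0 B t m \<le> (B * 2 powr (t + 1 / 2)) * (2 powr - (t + 1 / 2)) ^ m"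
proof (cases m)
  case 0
  have "1 \<le> 2 powr (t + 1 / 2)" using assms by (intro ge_one_powr_ge_zero) auto
  then show ?thesis using 0 assms mult_left_mono[of 1 "2 powr (t + 1 / 2)" B] by (simp add: coef_bound_def)
next
  case (Suc j)
  have "coef_bound J0 B t m = B * 2 powr - (real (J0 + j) * (t + 1 / 2))"
    by (simp only: coef_bound_def Suc nat.case powr_minus_divide times_divide_eq_right mult_1_right)
  also have "\<dots> \<le> B * 2 powr - (real j * (t + 1 / 2))"
    using assms by (intro mult_left_mono powr_mono) (auto intro: mult_right_mono)
  also have "2 powr - (real j * (t + 1 / 2)) = 2 powr (t + 1 / 2) * (2 powr - (t + 1 / 2)) ^ m"
    by (simp add: Suc powr_realpow[symmetric] powr_powr powr_add[symmetric] algebra_simps)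
  finally show ?thesis by simp
qed

lemma coef_bound_antimono:
  assumes "0 \<le> B" "r \<le> s"
  shows "coef_bound J0 B s m \<le> coef_bound J0 B r m"
proof (cases m)
  case (Suc j)
  have "2 powr (real (J0 + j) * (r + 1 / 2)) \<le> 2 powr (real (J0 + j) * (s + 1 / 2))"
    using assms by (intro powr_mono mult_left_mono) auto
  then show ?thesis using assms by (simp add: Suc coef_bound_def divide_left_mono)
qed (simp add: coef_bound_def)

theorem corollary1:
  fixes S J0 :: nat
    and scl :: "nat \<Rightarrow> real \<Rightarrow> real"
    and wav :: "nat \<Rightarrow> nat \<Rightarrow> real \<Rightarrow> real"
    and r s B \<alpha> :: real
  assumes basis: "daubechies_interval_basis S J0 scl wav"
    and "0 < r" and "r < s" and "s < real S"
    and "1 \<le> B" and "0 < \<alpha>" and "\<alpha> < 1"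
  defines "\<Sigma> \<equiv> (\<lambda>t. hoelder_densities J0 scl wav t B)"
  shows "\<Sigma> s \<union> \<Sigma> r = \<Sigma> r \<and>
    (\<exists>c c' :: nat \<Rightarrow> (nat \<Rightarrow> real) \<Rightarrow> real \<Rightarrow> real.
       (\<forall>n. random_band n (c n) (c' n)) \<and>
       (\<forall>f\<in>\<Sigma> s \<union> \<Sigma> r.
          liminf (\<lambda>n. ereal (coverage_prob f n (c n) (c' n))) \<ge> ereal (1 - \<alpha>)) \<and>
       (\<forall>f\<in>\<Sigma> s. ennreal_bigo (\<lambda>n. expected_diameter f n (c n) (c' n)) (rate s)) \<and>
       (\<forall>f\<in>\<Sigma> r. ennreal_bigo (\<lambda>n. expected_diameter f n (c n) (c' n)) (rate r)))"
proof -
  \<comment> \<open>Positive regularity is what makes the scaling function continuous.\<close>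
  have "0 < S" using assms(2-4) by simp
  then obtain D where "wavelet_system (graded_basis J0 scl wav) (graded_index J0) D (2 ^ J0)"
    using wavelet_system_interval_basis[OF basis] by blast
  then interpret wavelet_system "graded_basis J0 scl wav" "graded_index J0" D "2 ^ J0" .
  let ?b = "coef_bound J0 B"
  have class_eq: "\<Sigma> t = coef_class (?b t)" for t
    unfolding \<Sigma>_def hoelder_densities_def coef_class_def cont_density01_def hoelder_norm_le_iff
    by (auto simp only:)
  have mono: "?b s m \<le> ?b r m" for m
    using assms(3,5) by (intro coef_bound_antimono) auto
  have "\<Sigma> s \<subseteq> \<Sigma> r"
    unfolding class_eq coef_class_def using mono order_trans by fast
  then have union: "\<Sigma> s \<union> \<Sigma> r = \<Sigma> r" by blast
  show ?thesis
    unfolding union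
    using adaptive_band[OF assms(2,3,6) _ _ coef_bound_geometric coef_bound_geometric mono] assms(2,3,5)
    unfolding class_eq by simp
qed

end
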